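(* The average number $\mathbb{E}(C^{\mathrm{cv}}_n)$ of comparisons made by the dual-pivot quicksort algorithm ``Clairvoyant'' on a uniformly random permutation of $n$ distinct elements satisfies, as $n\to\infty$, $$\mathbb{E}(C^{\mathrm{cv}}_n)=\frac95 n\log n+An+B\log n+C+\frac{D}{n}+\frac{E}{n^2}+\frac{F\,[n\text{ even}]+G}{n^3}+O\Bigl(\frac1{n^4}\Bigr)$$ with $A=\frac95\gamma-\frac15\log 2-\frac{89}{25}=-2.6596412392892\dots$, $B=\frac{77}{40}$, $C=\frac{77}{40}\gamma-\frac{3}{40}\log 2+\frac{787}{800}=2.042904116393455\dots$, $D=\frac{13}{16}$, $E=-\frac{77}{480}$, $F=\frac18$, $G=-\frac{19}{400}$.
   Context: Notation: $\log$ is the natural logarithm, $\gamma$ is the Euler--Mascheroni constant, and $[\mathit{expr}]$ is $1$ if $\mathit{expr}$ is true and $0$ otherwise. Dual-pivot quicksort: the input is a sequence $(a_1,\dots,a_n)$ of $n$ distinct numbers in uniformly random order (w.l.o.g. a uniformly random permutation of $\{1,\dots,n\}$). If $n\le 1$, nothing is done (0 comparisons). If $n\ge2$, one comparison of $a_1$ and $a_n$ determines the pivots $p=\min(a_1,a_n)$ and $q=\max(a_1,a_n)$. Then the remaining $n-2$ elements $a_2,\dots,a_{n-1}$ are classified one after another as small ($<p$), medium (between $p$ and $q$) or large ($>q$). Each element is compared first with one of the two pivots, as prescribed by the classification strategy, and is then compared with the other pivot exactly if its class is not yet determined (so a small element costs 1 comparison if compared with $p$ first and 2 if compared with $q$ first;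 a large element costs 1 if compared with $q$ first and 2 if compared with $p$ first; a medium element always costs 2). Finally the algorithm is applied recursively, with the same strategy, to the group of small, the group of medium and the group of large elements (the inputs of the recursive calls are again in uniformly random order, e.g. if the original relative order is kept). Only comparisons between elements are counted. Strategy ``Clairvoyant'': let $s=p-1$ and $\ell=n-q$ be the total numbers of small and large elements for an input that is a permutation of $\{1,\dots,n\}$ (given by an oracle at no cost), and let $s_i$, $\ell_i$ be the numbers of elements classified as small, respectively large, among the first $i$ classified elements ($s_0=\ell_0=0$). When classifying the $i$th element, $1\le i\le n-2$: if $s-s_{i-1}\ge \ell-\ell_{i-1}$, compare with $p$ first, otherwise compare with $q$ first. $C^{\mathrm{cv}}_n$ is the random variable giving the total number of comparisons (including all recursive calls) when sorting $n$ elements with strategy ``Clairvoyant''. *)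

theory Defs
  imports
    "HOL-Probability.Probability"
    "HOL-Combinatorics.Multiset_Permutations"
begin

text \<open>
  A classification strategy gets the pivots \<open>p < q\<close>, the list of elements to be classified and the
  number \<open>i\<close> of elements classified so far; it returns whether the next element (at the 0-based
  index \<open>i\<close>) is compared with \<open>p\<close> first (otherwise with \<open>q\<close> first).  It may depend on the whole
  list, since the clairvoyant strategy consults an oracle.
\<close>

type_synonym 'a strategy = "'a \<Rightarrow> 'a \<Rightarrow> 'a list \<Rightarrow> nat \<Rightarrow> bool"

definition element_comparisons :: "'a::linorder \<Rightarrow> 'a \<Rightarrow> bool \<Rightarrow> 'a \<Rightarrow> nat" where
  "element_comparisons p q p_first x =
     (if p_first then (if x < p then 1 else 2) else (if q < x then 1 else 2))"

definition classification_comparisons ::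
    "'a::linorder strategy \<Rightarrow> 'a \<Rightarrow> 'a \<Rightarrow> 'a list \<Rightarrow> nat" where
  "classification_comparisons strat p q xs =
     (\<Sum>i<length xs. element_comparisons p q (strat p q xs i) (xs ! i))"

text \<open>
  Number of comparisons of dual-pivot quicksort on a list of distinct elements.  The leading \<open>1\<close> is
  the comparison of the two pivots.  The sublists passed to the recursive calls keep the original
  relative order.
\<close>

function quicksort_comparisons :: "'a::linorder strategy \<Rightarrow> 'a list \<Rightarrow> nat" where
  "quicksort_comparisons strat xs =
     (if length xs \<le> 1 then 0
      else
        (let p = min (hd xs) (last xs);
             q = max (hd xs) (last xs);
             ys = butlast (tl xs)
         in 1 + classification_comparisons strat p q ys
              + quicksort_comparisons strat (filter (\<lambda>x. x < p) ys)
              + quicksort_comparisons strat (filter (\<lambda>x. p < x \<and> x < q) ys)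
              + quicksort_comparisons strat (filter (\<lambda>x. q < x) ys)))"
  by pat_completeness auto
termination
  by (relation "Wellfounded.measure (\<lambda>(strat, xs). length xs)")
    (simp_all add: le_less_trans[OF length_filter_le])

declare quicksort_comparisons.simps [simp del]

definition num_small :: "'a::linorder \<Rightarrow> 'a list \<Rightarrow> nat" where
  "num_small p xs = length (filter (\<lambda>x. x < p) xs)"

definition num_large :: "'a::linorder \<Rightarrow> 'a list \<Rightarrow> nat" where
  "num_large q xs = length (filter (\<lambda>x. q < x) xs)"

text \<open>
  For a permutation of \<open>{1..n}\<close>, the total counts \<open>num_small p xs\<close> and \<open>num_large q xs\<close> of the
  elements to be classified are \<open>p - 1\<close> and \<open>n - q\<close>; counting also covers the sublists in
  recursive calls.  The subtractions on \<open>nat\<close> never truncate.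
\<close>

definition clairvoyant :: "'a::linorder strategy" where
  "clairvoyant p q xs i \<longleftrightarrow>
     num_small p xs - num_small p (take i xs) \<ge> num_large q xs - num_large q (take i xs)"

text \<open>The distribution of the number of comparisons on a uniformly random permutation.\<close>

definition clairvoyant_comparisons_pmf :: "nat \<Rightarrow> nat pmf" where
  "clairvoyant_comparisons_pmf n =
     map_pmf (quicksort_comparisons clairvoyant) (pmf_of_set (permutations_of_set {1..n}))"

end

theory Submission
  imports Defs "HOL-Real_Asymp.Real_Asymp"
begin

text \<open>
  Call the second comparison spent on a small or large element a miss.  For \<open>s\<close> small and \<open>l\<close> large
  elements, conditioning on the first of them gives
  \<open>(s + l) M(s, l) = min s l + s M(s - 1, l) + l M(s, l - 1)\<close> for the mean number \<open>M\<close> of misses, because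
  the oracle makes the first step miss exactly for the minority.  Uniform pivots make \<open>s\<close> uniform
  given \<open>N = s + l\<close>, and averaging over \<open>s\<close> turns the recurrence into a telescoping one:
  the mean \<open>V N\<close> increases by \<open>\<lfloor>N\<^sup>2/4\<rfloor> / (N (N + 1))\<close>.

  The quicksort recurrence, differenced twice, becomes a linear recurrence of order two, which from
  \<open>n = 4\<close> on is solved by an explicit combination of \<open>H\<^sub>n\<close>, \<open>H\<^bsub>\<lfloor>n/2\<rfloor>\<^esub>\<close> and rational functions
  of \<open>n\<close>, one for each parity.  Its expansion follows from two-sided bounds on the harmonic numbers,
  which also yield the digits of the Euler--Mascheroni constant.
\<close>

section \<open>Means over random permutations\<close>

abbreviation perm_mean :: "'a set \<Rightarrow> ('a list \<Rightarrow> real) \<Rightarrow> real" where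
  "perm_mean A f \<equiv> measure_pmf.expectation (pmf_of_set (permutations_of_set A)) f"

lemma perm_mean_eq_sum:
  "finite A \<Longrightarrow> perm_mean A f = (\<Sum>xs\<in>permutations_of_set A. f xs) / fact (card A)"
  by (subst integral_pmf_of_set) auto

lemma integrable_perm [simp]:
  fixes f :: "'a list \<Rightarrow> real"
  assumes "finite A"
  shows "integrable (measure_pmf (pmf_of_set (permutations_of_set A))) f"
  by (intro integrable_measure_pmf_finite) (use assms in auto)

lemma perm_mean_cong:
  assumes "finite A" "\<And>xs. set xs = A \<Longrightarrow> distinct xs \<Longrightarrow> f xs = g xs"
  shows "perm_mean A f = perm_mean A g"
  using assms by (auto simp: perm_mean_eq_sum dest: permutations_of_setD intro!: sum.cong)

text \<open>The head of a random permutation is uniform on \<open>A\<close>, and given the head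
  \<open>x\<close> the tail is a random permutation of \<open>A - {x}\<close>.\<close>

lemma perm_mean_Cons:
  assumes "finite A" "A \<noteq> {}"
  shows "perm_mean A f = (\<Sum>x\<in>A. perm_mean (A - {x}) (\<lambda>xs. f (x # xs))) / card A"
proof -
  have "perm_mean A f = (\<Sum>x\<in>A. measure_pmf.expectation
      (map_pmf ((#) x) (pmf_of_set (permutations_of_set (A - {x})))) f /\<^sub>R real (card A))"
    unfolding map_pmf_def using assms
    by (subst random_permutation_of_set, simp, simp, subst pmf_expectation_bind_pmf_of_set) auto
  then show ?thesis by (simp add: sum_divide_distrib divide_inverse_commute sum_distrib_left)
qed

lemma perm_mean_rev:
  assumes "finite A" shows "perm_mean A (\<lambda>xs. f (rev xs)) = perm_mean A f"
proof -
  have "(\<Sum>xs\<in>permutations_of_set A. f (rev xs)) = (\<Sum>xs\<in>rev ` permutations_of_set A. f xs)"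
    by (subst sum.reindex) (auto simp: inj_on_def)
  then show ?thesis using assms by (simp add: perm_mean_eq_sum)
qed

text \<open>Reversal preserves the uniform distribution, so conditioning on the last element reduces
  to conditioning on the first. Together the two rules expose both pivots.\<close>

lemma perm_mean_snoc:
  assumes "finite A" "A \<noteq> {}"
  shows "perm_mean A f = (\<Sum>x\<in>A. perm_mean (A - {x}) (\<lambda>xs. f (xs @ [x]))) / card A"
proof -
  have "perm_mean A f = perm_mean A (\<lambda>xs. f (rev xs))" using assms by (simp add: perm_mean_rev)
  also have "\<dots> = (\<Sum>x\<in>A. perm_mean (A - {x}) (\<lambda>xs. f (rev xs @ [x]))) / card A"
    by (subst perm_mean_Cons) (use assms in auto)
  also have "\<dots> = (\<Sum>x\<in>A. perm_mean (A - {x}) (\<lambda>xs. f (xs @ [x]))) / card A"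
    using assms by (subst perm_mean_rev) auto
  finally show ?thesis .
qed

text \<open>Partitioning a random permutation yields two independent random permutations; this is
  the first marginal. It guarantees that the inputs of the recursive calls are again uniformly
  random.\<close>

lemma perm_mean_filter:
  assumes "finite A"
  shows "perm_mean A (\<lambda>xs. f (filter P xs)) = perm_mean {x \<in> A. P x} f"
proof -
  have "map_pmf (filter P) (pmf_of_set (permutations_of_set A)) =
      map_pmf fst (map_pmf (partition P) (pmf_of_set (permutations_of_set A)))"
    by (simp add: pmf.map_comp o_def)
  also have "\<dots> = pmf_of_set (permutations_of_set {x \<in> A. P x})"
    by (simp add: partition_random_permutations[OF assms] map_fst_pair_pmf)
  finally have "perm_mean {x \<in> A. P x} f =
      measure_pmf.expectation (map_pmf (filter P) (pmf_of_set (permutations_of_set A))) f"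
    by simp
  then show ?thesis by simp
qed

section \<open>Mean number of misses in one classification\<close>

fun mean_misses :: "nat \<Rightarrow> nat \<Rightarrow> real" where
  "mean_misses 0 l = 0"
| "mean_misses s 0 = 0"
| "mean_misses (Suc s) (Suc l) =
     (real (min (Suc s) (Suc l)) + real (Suc s) * mean_misses s (Suc l)
        + real (Suc l) * mean_misses (Suc s) l) / real (Suc s + Suc l)"

lemma mean_misses_0_right [simp]: "mean_misses s 0 = 0"
  by (cases s) auto

text \<open>If \<open>s\<close> or \<open>l\<close> is zero, both sides vanish: the minimum is zero,
  and each truncated predecessor is multiplied by zero. Hence one recurrence covers the boundary as
  well.\<close>

lemma mean_misses_rec:
  "real (s + l) * mean_misses s l =
     real (min s l) + real s * mean_misses (s - 1) l + real l * mean_misses s (l - 1)"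
  by (cases s; cases l) auto

lemma classification_clairvoyant_Nil [simp]:
  "classification_comparisons clairvoyant p q [] = 0"
  by (simp add: classification_comparisons_def)

text \<open>The oracle compares the small and large elements still to come. Once the first element
  is classified, these are the totals of the tail, so the strategy continues as if started on the
  tail.\<close>

lemma classification_clairvoyant_Cons:
  "classification_comparisons clairvoyant p q (x # xs) =
     element_comparisons p q (num_large q (x # xs) \<le> num_small p (x # xs)) x
     + classification_comparisons clairvoyant p q xs"
proof -
  have "clairvoyant p q (x # xs) (Suc i) = clairvoyant p q xs i" for i
    by (simp add: clairvoyant_def num_small_def num_large_def)
  then show ?thesis
    unfolding classification_comparisons_def
    by (simp add: sum.lessThan_Suc_shift del: sum.lessThan_Suc)
      (simp add: clairvoyant_def num_small_def num_large_def)
qed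

lemma num_small_distinct: "distinct xs \<Longrightarrow> num_small p xs = card {x \<in> set xs. x < p}"
  unfolding num_small_def by (metis distinct_card distinct_filter set_filter)

lemma num_large_distinct: "distinct xs \<Longrightarrow> num_large q xs = card {x \<in> set xs. q < x}"
  unfolding num_large_def by (metis distinct_card distinct_filter set_filter)

text \<open>Each element costs one comparison, a medium one costs another, and
  \<open>mean_misses\<close> accounts for the rest. The induction conditions on the class of the
  first element. A medium element changes neither count that the oracle looks at, so the misses
  depend on the small and large elements only.\<close>

lemma mean_classification:
  fixes p q :: "'a::linorder"
  assumes "finite B" "p < q" "p \<notin> B" "q \<notin> B"
  shows "perm_mean B (\<lambda>xs. classification_comparisons clairvoyant p q xs)
    = real (card {x \<in> B. x < p}) + 2 * real (card {x \<in> B. p < x \<and> x < q})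
      + real (card {x \<in> B. q < x})
      + mean_misses (card {x \<in> B. x < p}) (card {x \<in> B. q < x})"
  using assms
proof (induction "card B" arbitrary: B)
  case 0
  then show ?case by (simp add: pmf_of_set_singleton)
next
  case (Suc n B)
  define s m l where "s = card {x \<in> B. x < p}" and "m = card {x \<in> B. p < x \<and> x < q}"
    and "l = card {x \<in> B. q < x}"
  define S M L where "S = {x \<in> B. x < p}" and "M = {x \<in> B. p < x \<and> x < q}" and "L = {x \<in> B. q < x}"
  have B: "B = S \<union> M \<union> L" using Suc.prems by (auto simp: S_def M_def L_def not_less le_less)
  have fin: "finite S" "finite M" "finite L" using Suc.prems by (auto simp: S_def M_def L_def)
  have disj: "S \<inter> M = {}" "(S \<union> M) \<inter> L = {}" using Suc.prems by (auto simp: S_def M_def L_def)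
  have slm: "s = card S" "m = card M" "l = card L"
    by (simp_all add: s_def m_def l_def S_def M_def L_def)
  have card_B: "card B = s + m + l"
    unfolding B slm using fin disj by (simp add: card_Un_disjoint)
  let ?c = "\<lambda>B. perm_mean B (\<lambda>xs. classification_comparisons clairvoyant p q xs)"
  let ?e = "\<lambda>x. real (element_comparisons p q (l \<le> s) x)"
  have step: "perm_mean (B - {x}) (\<lambda>xs. classification_comparisons clairvoyant p q (x # xs))
      = ?e x + ?c (B - {x})" if "x \<in> B" for x
  proof -
    have "perm_mean (B - {x}) (\<lambda>xs. classification_comparisons clairvoyant p q (x # xs))
      = perm_mean (B - {x}) (\<lambda>xs. ?e x + classification_comparisons clairvoyant p q xs)"
    proof (rule perm_mean_cong)
      fix xs assume "set xs = B - {x}" "distinct xs"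
      then have "distinct (x # xs)" "set (x # xs) = B" using that by auto
      then have "num_small p (x # xs) = s" "num_large q (x # xs) = l"
        by (simp_all only: num_small_distinct num_large_distinct s_def l_def)
      then show "real (classification_comparisons clairvoyant p q (x # xs))
          = ?e x + real (classification_comparisons clairvoyant p q xs)"
        by (simp add: classification_clairvoyant_Cons)
    qed (use Suc.prems in auto)
    also have "\<dots> = ?e x + ?c (B - {x})"
      using Suc.prems by simp
    finally show ?thesis .
  qed
  have IH: "?c (B - {x}) = real (card {y \<in> B - {x}. y < p}) + 2 * real (card {y \<in> B - {x}. p < y \<and> y < q})
      + real (card {y \<in> B - {x}. q < y})
      + mean_misses (card {y \<in> B - {x}. y < p}) (card {y \<in> B - {x}. q < y})" if "x \<in> B" for x
    by (rule Suc.hyps) (use Suc.prems Suc.hyps(2) that in auto)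
  have diff: "{y \<in> B - {x}. y < p} = S - {x}" "{y \<in> B - {x}. p < y \<and> y < q} = M - {x}"
    "{y \<in> B - {x}. q < y} = L - {x}" for x
    by (auto simp: S_def M_def L_def)
  let ?f = "\<lambda>x. perm_mean (B - {x}) (\<lambda>xs. classification_comparisons clairvoyant p q (x # xs))"
  have S: "?f x = (if l \<le> s then 1 else 2) + (real s - 1) + 2 * m + l + mean_misses (s - 1) l"
    if "x \<in> S" for x
  proof -
    have x: "x \<in> B" "x < p" "x \<notin> M" "x \<notin> L" "\<not> q < x" using that Suc.prems by (auto simp: S_def M_def L_def)
    moreover have "card S \<noteq> 0" using that fin by auto
    ultimately show ?thesis using that unfolding step[OF x(1)] IH[OF x(1)] diff
      by (simp add: element_comparisons_def slm card_Diff_singleton of_nat_diff)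
  qed
  have M: "?f x = 2 + s + 2 * (real m - 1) + l + mean_misses s l"
    if "x \<in> M" for x
  proof -
    have x: "x \<in> B" "\<not> x < p" "x \<notin> S" "x \<notin> L" "\<not> q < x" using that Suc.prems by (auto simp: S_def M_def L_def)
    moreover have "card M \<noteq> 0" using that fin by auto
    ultimately show ?thesis using that unfolding step[OF x(1)] IH[OF x(1)] diff
      by (simp add: element_comparisons_def slm card_Diff_singleton of_nat_diff)
  qed
  have L: "?f x = (if l \<le> s then 2 else 1) + s + 2 * m + (real l - 1) + mean_misses s (l - 1)"
    if "x \<in> L" for x
  proof -
    have x: "x \<in> B" "\<not> x < p" "x \<notin> M" "x \<notin> S" "q < x" using that Suc.prems by (auto simp: S_def M_def L_def)
    moreover have "card L \<noteq> 0" using that fin by auto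
    ultimately show ?thesis using that unfolding step[OF x(1)] IH[OF x(1)] diff
      by (simp add: element_comparisons_def slm card_Diff_singleton of_nat_diff)
  qed
  have "sum ?f B = sum ?f S + sum ?f M + sum ?f L"
    by (subst B) (use fin disj in \<open>simp add: sum.union_disjoint\<close>)
  also have "\<dots> = s * ((if l \<le> s then 1 else 2) + (real s - 1) + 2 * m + l + mean_misses (s - 1) l)
     + m * (2 + s + 2 * (real m - 1) + l + mean_misses s l)
     + l * ((if l \<le> s then 2 else 1) + s + 2 * m + (real l - 1) + mean_misses s (l - 1))"
    using S M L by (simp add: slm)
  \<comment> \<open>If \<open>l\<close> is at most \<open>s\<close>, the \<open>l\<close> large
    choices of the first element miss, otherwise the \<open>s\<close> small ones do; either way this
    contributes \<open>min s l\<close>. The medium choices add \<open>m * mean_misses s l\<close>,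
    which extends the factor \<open>s + l\<close> of the recurrence to
    \<open>s + m + l\<close>.\<close>
  also have "\<dots> = real (s + m + l) * (real s + 2 * real m + real l + mean_misses s l)"
    using mean_misses_rec[of s l] by (auto simp: algebra_simps)
  finally have "sum ?f B = real (card B) * (real s + 2 * real m + real l + mean_misses s l)"
    by (simp add: card_B)
  moreover have "B \<noteq> {}" using Suc.hyps(2) by auto
  ultimately show ?case unfolding s_def[symmetric] m_def[symmetric] l_def[symmetric]
    using Suc.hyps(2) by (subst perm_mean_Cons) (use Suc.prems in auto)
qed

section \<open>The quicksort recurrence\<close>

lemma quicksort_comparisons_snoc:
  shows "quicksort_comparisons strat (a # ys @ [b]) =
    1 + classification_comparisons strat (min a b) (max a b) ys
      + quicksort_comparisons strat (filter (\<lambda>x. x < min a b) ys)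
      + quicksort_comparisons strat (filter (\<lambda>x. min a b < x \<and> x < max a b) ys)
      + quicksort_comparisons strat (filter (\<lambda>x. max a b < x) ys)"
  by (subst quicksort_comparisons.simps) (simp add: Let_def)

text \<open>The pair of first and last element is uniform among the ordered pairs of distinct
  elements, and the elements between them form a random permutation of the remaining set. By
  \<open>perm_mean_filter\<close> the three groups are then in random order too.\<close>

lemma perm_mean_quicksort:
  fixes A :: "'a::linorder set"
  assumes "finite A" "card A \<ge> 2"
  defines "E \<equiv> \<lambda>B. perm_mean B (\<lambda>xs. real (quicksort_comparisons clairvoyant xs))"
  shows "real (card A) * (real (card A) - 1) * E A = (\<Sum>a\<in>A. \<Sum>b\<in>A - {a}.
      1 + perm_mean (A - {a, b}) (\<lambda>xs. real (classification_comparisons clairvoyant (min a b) (max a b) xs))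
      + E {x \<in> A. x < min a b} + E {x \<in> A. min a b < x \<and> x < max a b} + E {x \<in> A. max a b < x})"
proof -
  let ?q = "quicksort_comparisons (clairvoyant :: 'a strategy)"
  have ne: "A \<noteq> {}" using assms by auto
  have inner: "perm_mean (A - {a} - {b}) (\<lambda>xs. ?q (a # xs @ [b])) =
      1 + perm_mean (A - {a, b}) (\<lambda>xs. real (classification_comparisons clairvoyant (min a b) (max a b) xs))
      + E {x \<in> A. x < min a b} + E {x \<in> A. min a b < x \<and> x < max a b} + E {x \<in> A. max a b < x}"
    if "a \<in> A" "b \<in> A - {a}" for a b
  proof -
    have [simp]: "finite (A - {a, b})" using assms by simp
    have eq: "A - {a} - {b} = A - {a, b}" by auto
    \<comment> \<open>No pivot satisfies any of these strict inequalities, so removing both pivots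
      leaves the three groups unchanged.\<close>
    have sets: "{x \<in> A. x < min a b} = {x \<in> A - {a, b}. x < min a b}"
      "{x \<in> A. min a b < x \<and> x < max a b} = {x \<in> A - {a, b}. min a b < x \<and> x < max a b}"
      "{x \<in> A. max a b < x} = {x \<in> A - {a, b}. max a b < x}"
      by (auto simp: min_def max_def)
    have E_filter: "E {x \<in> A - {a, b}. P x} = perm_mean (A - {a, b}) (\<lambda>xs. real (?q (filter P xs)))" for P
      unfolding E_def by (rule perm_mean_filter[symmetric]) (simp add: assms)
    show ?thesis
      unfolding quicksort_comparisons_snoc eq sets E_filter using assms(1)
      by (simp del: min_less_iff_conj max_less_iff_conj)
  qed
  have "card (A - {a}) = card A - 1" if "a \<in> A" for a using that assms by simp
  moreover have "A - {a} \<noteq> {}" if "a \<in> A" for a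
    using calculation[OF that] assms(2) by (metis One_nat_def Suc_1 card.empty diff_is_0_eq not_less_eq_eq)
  ultimately have outer: "perm_mean (A - {a}) (\<lambda>xs. ?q (a # xs)) =
      (\<Sum>b\<in>A - {a}. perm_mean (A - {a} - {b}) (\<lambda>xs. ?q (a # xs @ [b]))) / (real (card A) - 1)"
    if "a \<in> A" for a
    using that assms by (subst perm_mean_snoc) (auto simp: of_nat_diff)
  have "E A = (\<Sum>a\<in>A. perm_mean (A - {a}) (\<lambda>xs. ?q (a # xs))) / card A"
    unfolding E_def using assms ne by (subst perm_mean_Cons) auto
  also have "\<dots> = (\<Sum>a\<in>A. (\<Sum>b\<in>A - {a}. perm_mean (A - {a} - {b}) (\<lambda>xs. ?q (a # xs @ [b])))
      / (real (card A) - 1)) / card A"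
    by (simp add: outer)
  also have "\<dots> = (\<Sum>a\<in>A. \<Sum>b\<in>A - {a}. perm_mean (A - {a} - {b}) (\<lambda>xs. ?q (a # xs @ [b])))
      / (real (card A) * (real (card A) - 1))"
    by (simp add: sum_divide_distrib[symmetric])
  finally have "real (card A) * (real (card A) - 1) * E A =
      (\<Sum>a\<in>A. \<Sum>b\<in>A - {a}. perm_mean (A - {a} - {b}) (\<lambda>xs. ?q (a # xs @ [b])))"
    using assms by simp
  then show ?thesis by (simp add: inner)
qed

section \<open>From pivot values to pivot ranks\<close>

lemma sum_offdiag_eq_double:
  fixes n :: nat and g :: "nat \<Rightarrow> nat \<Rightarrow> 'b::comm_semiring_1"
  shows "(\<Sum>i<n. \<Sum>j\<in>{..<n} - {i}. g (min i j) (max i j)) = 2 * (\<Sum>j<n. \<Sum>i<j. g i j)"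
proof -
  let ?L = "{(i, j). i < j \<and> j < n}"
  let ?R = "{(i, j). j < i \<and> i < n}"
  have fin: "finite ?L" "finite ?R"
    by (rule finite_subset[of _ "{..<n} \<times> {..<n}"]; auto)+
  have "(\<Sum>i<n. \<Sum>j\<in>{..<n} - {i}. g (min i j) (max i j))
      = (\<Sum>(i, j)\<in>Sigma {..<n} (\<lambda>i. {..<n} - {i}). g (min i j) (max i j))"
    by (simp add: sum.Sigma)
  also have "Sigma {..<n} (\<lambda>i. {..<n} - {i}) = ?L \<union> ?R" by auto
  also have "(\<Sum>(i, j)\<in>\<dots>. g (min i j) (max i j)) =
      (\<Sum>(i, j)\<in>?L. g (min i j) (max i j)) + (\<Sum>(i, j)\<in>?R. g (min i j) (max i j))"
    by (rule sum.union_disjoint) (use fin in auto)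
  also have "(\<Sum>(i, j)\<in>?R. g (min i j) (max i j)) = (\<Sum>(i, j)\<in>?L. g (min i j) (max i j))"
    by (rule sum.reindex_bij_witness[of _ prod.swap prod.swap]) (auto simp: min.commute max.commute)
  also have "(\<Sum>(i, j)\<in>?L. g (min i j) (max i j)) = (\<Sum>(i, j)\<in>?L. g i j)"
    by (rule sum.cong) auto
  also have "\<dots> = (\<Sum>j<n. \<Sum>i<j. g i j)"
    by (subst sum.Sigma) (auto intro!: sum.reindex_bij_witness[of _ prod.swap prod.swap])
  finally show ?thesis by (simp add: mult_2)
qed

text \<open>The increasing enumeration \<open>e\<close> of \<open>A\<close> replaces elements by
  ranks. Pivots of ranks \<open>i < j\<close> leave \<open>i\<close> small, \<open>j - i - 1\<close>
  medium and \<open>card A - 1 - j\<close> large elements.\<close>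

lemma sum_pivot_pairs:
  fixes A :: "nat set" and h :: "nat \<Rightarrow> nat \<Rightarrow> nat \<Rightarrow> 'b::comm_semiring_1"
  assumes "finite A"
  shows "(\<Sum>a\<in>A. \<Sum>b\<in>A - {a}. h (card {x \<in> A. x < min a b})
      (card {x \<in> A. min a b < x \<and> x < max a b}) (card {x \<in> A. max a b < x}))
    = 2 * (\<Sum>j<card A. \<Sum>i<j. h i (j - i - 1) (card A - 1 - j))"
proof -
  let ?n = "card A"
  obtain e where bij: "bij_betw e {..<?n} A" and mono: "strict_mono_on {..<?n} e"
    using ex_bij_betw_strict_mono_card[OF assms] by blast
  have less: "e i < e j \<longleftrightarrow> i < j" if "i < ?n" "j < ?n" for i j
    using strict_mono_on_less[OF mono, of i j] that by simp
  have inj: "inj_on e {..<?n}" and img: "e ` {..<?n} = A"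
    using bij_betw_imp_inj_on[OF bij] bij_betw_imp_surj_on[OF bij] .
  have card_eq: "card {x \<in> A. P x} = card {i. i < ?n \<and> P (e i)}" for P
  proof -
    have "{x \<in> A. P x} = e ` {i. i < ?n \<and> P (e i)}" using img by fastforce
    moreover have "inj_on e {i. i < ?n \<and> P (e i)}" by (rule inj_on_subset[OF inj]) auto
    ultimately show ?thesis by (simp add: card_image)
  qed
  have minmax: "min (e i) (e j) = e (min i j)" "max (e i) (e j) = e (max i j)" if "i < ?n" "j < ?n" for i j
    using less[OF that] less[OF that(2,1)] by (auto simp: min_def max_def)
  have c: "card {x \<in> A. x < e i} = i" "card {x \<in> A. e i < x} = ?n - 1 - i"
    "card {x \<in> A. e i < x \<and> x < e j} = j - i - 1" if "i < ?n" "j < ?n" for i j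
  proof -
    have "{k. k < ?n \<and> e k < e i} = {..<i}" "{k. k < ?n \<and> e i < e k} = {i<..<?n}"
      "{k. k < ?n \<and> e i < e k \<and> e k < e j} = {i<..<j}"
      using less that by auto
    then show "card {x \<in> A. x < e i} = i" "card {x \<in> A. e i < x} = ?n - 1 - i"
      "card {x \<in> A. e i < x \<and> x < e j} = j - i - 1"
      unfolding card_eq by simp_all
  qed
  let ?H = "\<lambda>a b. h (card {x \<in> A. x < min a b})
      (card {x \<in> A. min a b < x \<and> x < max a b}) (card {x \<in> A. max a b < x})"
  have "(\<Sum>a\<in>A. \<Sum>b\<in>A - {a}. ?H a b) = (\<Sum>i<?n. \<Sum>b\<in>A - {e i}. ?H (e i) b)"
    by (rule sum.reindex_bij_betw[OF bij, symmetric])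
  also have "\<dots> = (\<Sum>i<?n. \<Sum>j\<in>{..<?n} - {i}. ?H (e i) (e j))"
  proof (rule sum.cong[OF refl])
    fix i assume "i \<in> {..<?n}"
    then have "bij_betw e ({..<?n} - {i}) (A - {e i})"
      using bij by (intro bij_betw_DiffI) (auto intro: bij_betw_apply[OF bij])
    from sum.reindex_bij_betw[OF this, symmetric]
    show "(\<Sum>b\<in>A - {e i}. ?H (e i) b) = (\<Sum>j\<in>{..<?n} - {i}. ?H (e i) (e j))" .
  qed
  also have "\<dots> = (\<Sum>i<?n. \<Sum>j\<in>{..<?n} - {i}. h (min i j) (max i j - min i j - 1) (?n - 1 - max i j))"
    by (intro sum.cong refl) (auto simp: minmax c)
  also have "\<dots> = 2 * (\<Sum>j<?n. \<Sum>i<j. h i (j - i - 1) (?n - 1 - j))"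
    by (rule sum_offdiag_eq_double[of "\<lambda>i j. h i (j - i - 1) (?n - 1 - j)"])
  finally show ?thesis .
qed

text \<open>The set \<open>{..<n}\<close> serves as a representative:
  \<open>perm_mean_quicksort_eq\<close> shows that all sets of \<open>n\<close> naturals share this
  mean.\<close>

definition mean_comparisons :: "nat \<Rightarrow> real" where
  "mean_comparisons n =
     perm_mean {..<n} (\<lambda>xs. real (quicksort_comparisons clairvoyant xs))"

lemma perm_mean_quicksort_small:
  assumes "finite A" "card A < 2"
  shows "perm_mean A (\<lambda>xs. real (quicksort_comparisons strat xs)) = 0"
proof -
  have "perm_mean A (\<lambda>xs. real (quicksort_comparisons strat xs)) = perm_mean A (\<lambda>_. 0)"
  proof (rule perm_mean_cong[OF assms(1)])
    fix xs assume "set xs = A" "distinct xs"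
    then have "length xs \<le> 1" using assms(2) distinct_card[of xs] by auto
    then show "real (quicksort_comparisons strat xs) = 0" by (simp add: quicksort_comparisons.simps)
  qed
  then show ?thesis by simp
qed

text \<open>The function \<open>c\<close> and the hypothesis on smaller sets let this recurrence be
  used inside the induction that proves the mean to depend on the cardinality only, before this is
  known for \<open>n\<close> itself.\<close>

lemma perm_mean_quicksort_ranks:
  fixes A :: "nat set"
  assumes "finite A" "card A = n" "n \<ge> 2"
    and smaller: "\<And>B :: nat set. finite B \<Longrightarrow> card B < n \<Longrightarrow>
      perm_mean B (\<lambda>xs. real (quicksort_comparisons clairvoyant xs)) = c (card B)"
  shows "real n * (real n - 1) * perm_mean A (\<lambda>xs. real (quicksort_comparisons clairvoyant xs)) =
    2 * (\<Sum>j<n. \<Sum>i<j. 1 + (real i + 2 * real (j - i - 1) + real (n - 1 - j) + mean_misses i (n - 1 - j))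
      + (c i + c (j - i - 1) + c (n - 1 - j)))"
proof -
  define h where "h = (\<lambda>s m l. 1 + (real s + 2 * real m + real l + mean_misses s l) + (c s + c m + c l))"
  let ?E = "\<lambda>B :: nat set. perm_mean B (\<lambda>xs. real (quicksort_comparisons clairvoyant xs))"
  have "1 + perm_mean (A - {a, b}) (\<lambda>xs. real (classification_comparisons clairvoyant (min a b) (max a b) xs))
      + ?E {x \<in> A. x < min a b} + ?E {x \<in> A. min a b < x \<and> x < max a b} + ?E {x \<in> A. max a b < x}
    = h (card {x \<in> A. x < min a b}) (card {x \<in> A. min a b < x \<and> x < max a b}) (card {x \<in> A. max a b < x})"
    if "a \<in> A" "b \<in> A - {a}" for a b
  proof -
    have sets: "{x \<in> A - {a, b}. x < min a b} = {x \<in> A. x < min a b}"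
      "{x \<in> A - {a, b}. min a b < x \<and> x < max a b} = {x \<in> A. min a b < x \<and> x < max a b}"
      "{x \<in> A - {a, b}. max a b < x} = {x \<in> A. max a b < x}"
      by (auto simp: min_def max_def)
    \<comment> \<open>The pivot \<open>a\<close> is missing from the group, which is therefore a
      proper subset of \<open>A\<close> and has fewer than \<open>n\<close> elements.\<close>
    have IH: "?E {x \<in> A. P x} = c (card {x \<in> A. P x})" if "\<not> P a" for P
      using that \<open>a \<in> A\<close> assms by (intro smaller) (auto intro!: psubset_card_mono)
    have "perm_mean (A - {a, b}) (\<lambda>xs. real (classification_comparisons clairvoyant (min a b) (max a b) xs))
      = real (card {x \<in> A. x < min a b}) + 2 * real (card {x \<in> A. min a b < x \<and> x < max a b})
        + real (card {x \<in> A. max a b < x})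
        + mean_misses (card {x \<in> A. x < min a b}) (card {x \<in> A. max a b < x})"
      unfolding sets[symmetric]
      by (rule mean_classification) (use that assms in \<open>auto simp: min_def max_def\<close>)
    then show ?thesis unfolding h_def by (subst (1 2 3) IH) (auto simp: min_def max_def)
  qed
  then have "real n * (real n - 1) * ?E A = (\<Sum>a\<in>A. \<Sum>b\<in>A - {a}.
      h (card {x \<in> A. x < min a b}) (card {x \<in> A. min a b < x \<and> x < max a b}) (card {x \<in> A. max a b < x}))"
    using perm_mean_quicksort[of A] assms by simp
  also have "\<dots> = 2 * (\<Sum>j<n. \<Sum>i<j. h i (j - i - 1) (n - 1 - j))"
    using sum_pivot_pairs[OF assms(1), of h] assms(2) by simp
  finally show ?thesis unfolding h_def .
qed

text \<open>By induction, the right-hand side of the rank recurrence is the same for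
  \<open>A\<close> and for \<open>{..<card A}\<close>; the factor
  \<open>card A * (card A - 1)\<close> cancels.\<close>

lemma perm_mean_quicksort_eq:
  fixes A :: "nat set"
  assumes "finite A"
  shows "perm_mean A (\<lambda>xs. real (quicksort_comparisons clairvoyant xs)) = mean_comparisons (card A)"
  using assms
proof (induction "card A" arbitrary: A rule: less_induct)
  case (less A)
  show ?case
  proof (cases "card A < 2")
    case True
    then show ?thesis using less.prems by (simp add: perm_mean_quicksort_small mean_comparisons_def)
  next
    case False
    have "real (card A) * (real (card A) - 1) *
        perm_mean A (\<lambda>xs. real (quicksort_comparisons clairvoyant xs)) =
      real (card A) * (real (card A) - 1) *
        perm_mean {..<card A} (\<lambda>xs. real (quicksort_comparisons clairvoyant xs))"
      using less False
      by (subst (1 2) perm_mean_quicksort_ranks[where n = "card A" and c = mean_comparisons]) auto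
    then show ?thesis using False by (simp add: mean_comparisons_def)
  qed
qed

text \<open>The three group sizes \<open>i\<close>, \<open>j - i - 1\<close> and
  \<open>n - 1 - j\<close> are equidistributed over the pivot pairs. The first identity reverses the
  inner sum; in the second, both sides count the value at \<open>k\<close> exactly
  \<open>n - 1 - k\<close> times.\<close>

lemma sum_triangle:
  fixes f :: "nat \<Rightarrow> real"
  shows "(\<Sum>j<n. \<Sum>i<j. f (j - i - 1)) = (\<Sum>j<n. \<Sum>i<j. f i)"
    and "(\<Sum>j<n. \<Sum>i<j. f (n - 1 - j)) = (\<Sum>j<n. \<Sum>i<j. f i)"
proof -
  show "(\<Sum>j<n. \<Sum>i<j. f (j - i - 1)) = (\<Sum>j<n. \<Sum>i<j. f i)"
    using sum.nat_diff_reindex[of f] by simp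
  have "(\<Sum>j<n. \<Sum>i<j. f (n - 1 - j)) = (\<Sum>j<n. real j * f (n - Suc j))" by simp
  also have "\<dots> = (\<Sum>j<n. real (n - Suc j) * f j)"
    by (subst sum.nat_diff_reindex[symmetric]) (auto intro!: sum.cong)
  also have "\<dots> = (\<Sum>j<n. \<Sum>i<j. f i)"
  proof (induction n)
    case (Suc n)
    have "(\<Sum>j<Suc n. real (Suc n - Suc j) * f j) = (\<Sum>j<n. real (n - Suc j) * f j + f j)"
      by (auto intro!: sum.cong simp: of_nat_diff algebra_simps)
    with Suc show ?case by (simp add: sum.distrib)
  qed simp
  finally show "(\<Sum>j<n. \<Sum>i<j. f (n - 1 - j)) = (\<Sum>j<n. \<Sum>i<j. f i)" .
qed

section \<open>Misses averaged over the pivots\<close>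

definition miss_average :: "nat \<Rightarrow> real" where
  "miss_average N = (\<Sum>k=1..N. real (k ^ 2 div 4) / (real k * real (k + 1)))"

lemma miss_average_Suc:
  "miss_average (Suc N) = miss_average N + real (Suc N ^ 2 div 4) / (real (Suc N) * real (N + 2))"
  by (simp add: miss_average_def)

text \<open>From \<open>N\<close> to \<open>N + 2\<close>, the two outer terms of the new sum are
  zero and the \<open>N + 1\<close> inner ones are the old terms increased by one; correspondingly
  \<open>N ^ 2 div 4\<close> grows by \<open>N + 1\<close>.\<close>

lemma sum_min_antidiagonal:
  fixes N :: nat
  shows "(\<Sum>s\<le>N. min s (N - s)) = N ^ 2 div 4"
proof (induction N rule: induct_nat_012)
  case (ge2 N)
  have "(\<Sum>s\<le>Suc (Suc N). min s (Suc (Suc N) - s)) = (\<Sum>s\<le>Suc N. min (Suc s) (Suc N - s))"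
    by (subst sum.atMost_Suc_shift) simp
  also have "\<dots> = (\<Sum>s\<le>N. min (Suc s) (Suc N - s))" by simp
  also have "\<dots> = (\<Sum>s\<le>N. Suc (min s (N - s)))"
    by (intro sum.cong refl) (auto simp: Suc_diff_le)
  also have "\<dots> = N ^ 2 div 4 + (N + 1)" by (subst sum_Suc) (use ge2 in simp)
  also have "\<dots> = (N ^ 2 + (N + 1) * 4) div 4" by simp
  also have "N ^ 2 + (N + 1) * 4 = (Suc (Suc N)) ^ 2" by (simp add: power2_eq_square)
  finally show ?case .
qed auto

text \<open>This identifies \<open>miss_average N\<close> as the mean number of misses for uniform
  \<open>s\<close> and \<open>l = N - s\<close>. The recurrence is summed over the antidiagonal
  \<open>s + l = N + 1\<close>.\<close>

lemma sum_mean_misses: "(\<Sum>s\<le>N. mean_misses s (N - s)) = real (N + 1) * miss_average N"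
proof (induction N)
  case 0
  then show ?case by (simp add: miss_average_def)
next
  case (Suc N)
  let ?M = "Suc N"
  have "real ?M * (\<Sum>s\<le>?M. mean_misses s (?M - s)) =
      (\<Sum>s\<le>?M. real (min s (?M - s)) + real s * mean_misses (s - 1) (?M - s)
        + real (?M - s) * mean_misses s (?M - s - 1))"
    unfolding sum_distrib_left using mean_misses_rec[of _ "?M - _"]
    by (intro sum.cong refl) (metis le_add_diff_inverse atMost_iff)
  also have "\<dots> = real (?M ^ 2 div 4) + (\<Sum>s\<le>?M. real s * mean_misses (s - 1) (?M - s))
        + (\<Sum>s\<le>?M. real (?M - s) * mean_misses s (?M - s - 1))"
    by (simp add: sum.distrib sum_min_antidiagonal[symmetric] del: sum.atMost_Suc)
  also have "(\<Sum>s\<le>?M. real s * mean_misses (s - 1) (?M - s))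
      = (\<Sum>s\<le>N. real (Suc s) * mean_misses s (N - s))"
    by (subst sum.atMost_Suc_shift) simp
  also have "(\<Sum>s\<le>?M. real (?M - s) * mean_misses s (?M - s - 1))
      = (\<Sum>s\<le>N. real (Suc N - s) * mean_misses s (N - s))"
    by simp
  finally have "real ?M * (\<Sum>s\<le>?M. mean_misses s (?M - s)) = real (?M ^ 2 div 4)
      + (\<Sum>s\<le>N. real (Suc s) * mean_misses s (N - s) + real (Suc N - s) * mean_misses s (N - s))"
    by (simp add: sum.distrib)
  also have "(\<Sum>s\<le>N. real (Suc s) * mean_misses s (N - s) + real (Suc N - s) * mean_misses s (N - s))
      = (\<Sum>s\<le>N. real (N + 2) * mean_misses s (N - s))"
    \<comment> \<open>The weights \<open>s + 1\<close> and \<open>N + 1 - s\<close> add up to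
      \<open>N + 2\<close> whatever \<open>s\<close> is, so the previous antidiagonal enters only
      through its total.\<close>
    by (intro sum.cong refl) (auto simp: of_nat_diff algebra_simps)
  also have "\<dots> = real (N + 2) * (real (N + 1) * miss_average N)"
    by (simp only: sum_distrib_left[symmetric] Suc)
  finally have "real ?M * (\<Sum>s\<le>?M. mean_misses s (?M - s)) =
      real (?M ^ 2 div 4) + real (N + 2) * (real (N + 1) * miss_average N)" .
  also have "\<dots> = real ?M * (real (?M + 1) * miss_average ?M)"
    unfolding miss_average_Suc distrib_left by simp
  finally show ?case by (simp del: sum.atMost_Suc)
qed

text \<open>Pivot pairs are grouped by the joint number \<open>N = i + (n - 1 - j)\<close> of small
  and large elements. For each \<open>N < n - 1\<close>, every \<open>i\<close> from 0 to
  \<open>N\<close> occurs exactly once.\<close>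

lemma sum_mean_misses_triangle:
  "(\<Sum>j<n. \<Sum>i<j. mean_misses i (n - 1 - j)) = (\<Sum>N<n - 1. real (N + 1) * miss_average N)"
proof -
  have "(\<Sum>j<n. \<Sum>i<j. mean_misses i (n - 1 - j)) =
      (\<Sum>(j, i)\<in>Sigma {..<n} lessThan. mean_misses i (n - 1 - j))"
    by (simp add: sum.Sigma)
  also have "\<dots> = (\<Sum>(N, s)\<in>Sigma {..<n - 1} atMost. mean_misses s (N - s))"
    by (rule sum.reindex_bij_witness[of _ "\<lambda>(N, s). (n - 1 - N + s, s)" "\<lambda>(j, i). (n - 1 - j + i, i)"]) auto
  also have "\<dots> = (\<Sum>N<n - 1. real (N + 1) * miss_average N)"
    by (simp add: sum.Sigma[symmetric] sum_mean_misses)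
  finally show ?thesis .
qed

section \<open>The recurrence for the mean number of comparisons\<close>

lemma sum_triangle_id: "(\<Sum>j<n. \<Sum>i<j. real i) = real n * (real n - 1) * (real n - 2) / 6"
proof (induction n)
  case (Suc n)
  have gauss: "(\<Sum>i<n. real i) = real n * (real n - 1) / 2"
    by (induction n) (auto simp: field_simps)
  show ?case unfolding sum.lessThan_Suc Suc gauss by (simp add: field_simps)
qed simp

lemma sum_triangle_1: "(\<Sum>j<n. \<Sum>i<j. 1 :: real) = real n * (real n - 1) / 2"
  by (induction n) (auto simp: field_simps)

text \<open>As the group sizes are equidistributed, the costs 1, 2 and 1 per element combine to a
  factor 4, and the three recursive calls to a factor 3, doubled because either pivot may come
  first.\<close>

lemma mean_comparisons_sum:
  "real n * (real n - 1) * mean_comparisons n =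
    real n * (real n - 1) * (4 * real n - 5) / 3
    + 2 * (\<Sum>N<n - 1. real (N + 1) * miss_average N)
    + 6 * (\<Sum>j<n. \<Sum>i<j. mean_comparisons i)"
proof (cases "n < 2")
  case True
  then have "n = 0 \<or> n = 1" by auto
  then show ?thesis by (auto simp: mean_comparisons_def perm_mean_quicksort_small)
next
  case False
  let ?c = mean_comparisons
  have "real n * (real n - 1) * ?c n =
    2 * (\<Sum>j<n. \<Sum>i<j. 1 + (real i + 2 * real (j - i - 1) + real (n - 1 - j) + mean_misses i (n - 1 - j))
      + (?c i + ?c (j - i - 1) + ?c (n - 1 - j)))"
    unfolding mean_comparisons_def[of n] using False
    by (intro perm_mean_quicksort_ranks) (auto intro: perm_mean_quicksort_eq)
  also have "\<dots> = 2 * ((\<Sum>j<n. \<Sum>i<j. 1) + ((\<Sum>j<n. \<Sum>i<j. real i)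
      + 2 * (\<Sum>j<n. \<Sum>i<j. real (j - i - 1)) + (\<Sum>j<n. \<Sum>i<j. real (n - 1 - j))
      + (\<Sum>j<n. \<Sum>i<j. mean_misses i (n - 1 - j)))
      + ((\<Sum>j<n. \<Sum>i<j. ?c i) + (\<Sum>j<n. \<Sum>i<j. ?c (j - i - 1)) + (\<Sum>j<n. \<Sum>i<j. ?c (n - 1 - j))))"
    unfolding sum.distrib sum_distrib_left[symmetric] ..
  also have "\<dots> = 2 * (real n * (real n - 1) / 2 + 4 * (real n * (real n - 1) * (real n - 2) / 6)
      + (\<Sum>N<n - 1. real (N + 1) * miss_average N) + 3 * (\<Sum>j<n. \<Sum>i<j. ?c i))"
    unfolding sum_triangle sum_triangle(1)[of real] sum_triangle(2)[of real]
      sum_mean_misses_triangle sum_triangle_id sum_triangle_1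
    by simp
  finally show ?thesis by (simp add: field_simps)
qed

text \<open>The coefficient of \<open>c\<^sub>n\<close> is \<open>n (n - 1) - 6 = (n - 3) (n + 2)\<close>.\<close>

lemma mean_comparisons_rec:
  "real (n + 2) * real (n + 1) * mean_comparisons (n + 2) =
     2 * real (n + 1) * real n * mean_comparisons (n + 1)
     - (real n - 3) * real (n + 2) * mean_comparisons n
     + 8 * real n + 2 + 2 * miss_average n + 2 * real (n ^ 2 div 4) / real (n + 1)"
proof -
  define W where "W = (\<lambda>n. \<Sum>N<n - 1. real (N + 1) * miss_average N)"
  define T where "T = (\<lambda>n. \<Sum>j<n. \<Sum>i<j. mean_comparisons i)"
  have c: "real n * (real n - 1) * mean_comparisons n =
      real n * (real n - 1) * (4 * real n - 5) / 3 + 2 * W n + 6 * T n" for n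
    unfolding W_def T_def by (rule mean_comparisons_sum)
  have T: "T (n + 2) - 2 * T (n + 1) + T n = mean_comparisons n" by (simp add: T_def)
  \<comment> \<open>Since \<open>W\<close> sums up to \<open>n - 2\<close>, its second difference is
    a first difference of \<open>(N + 1) * miss_average N\<close>, and the increment of
    \<open>miss_average\<close> supplies the quotient. For \<open>n = 0\<close> the subtraction
    truncates, so that case is separate.\<close>
  have W: "W (n + 2) - 2 * W (n + 1) + W n = miss_average n + real (n ^ 2 div 4) / real (n + 1)"
  proof (cases n)
    case (Suc m)
    have "real (m + 2) * miss_average (Suc m) - real (m + 1) * miss_average m
      = miss_average (Suc m) + real (Suc m) * (miss_average (Suc m) - miss_average m)"
      by (simp add: algebra_simps)
    also have "\<dots> = miss_average n + real (n ^ 2 div 4) / real (n + 1)"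
      unfolding miss_average_Suc Suc by simp
    finally show ?thesis by (simp add: W_def Suc algebra_simps)
  qed (simp add: W_def miss_average_def)
  define x where "x = real n"
  have real_n: "real n = x" "real (n + 1) = x + 1" "real (n + 2) = x + 2"
    by (simp_all add: x_def)
  define r where "r = real (n ^ 2 div 4) / (x + 1)"
  have r: "2 * real (n ^ 2 div 4) / (x + 1) = 2 * r" by (simp add: r_def)
  \<comment> \<open>The instances of \<open>c\<close> at \<open>n\<close>, \<open>n + 1\<close> and
    \<open>n + 2\<close>, weighted 1, -2 and 1, eliminate \<open>T\<close> and \<open>W\<close>
    through their second differences.\<close>
  note eqs = c[of n, unfolded real_n] c[of "n + 1", unfolded real_n] c[of "n + 2", unfolded real_n]
    T W[unfolded real_n r_def[symmetric]]
  show ?thesis unfolding real_n r using eqs by algebra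
qed

lemma expectation_clairvoyant:
  "measure_pmf.expectation (clairvoyant_comparisons_pmf n) real = mean_comparisons n"
  unfolding clairvoyant_comparisons_pmf_def by (simp add: perm_mean_quicksort_eq)

section \<open>Closed form\<close>

text \<open>This is half the sum of the odd reciprocals from 1/3 to 1/(2k + 1), expressed by
  harmonic numbers because the closed form is stated in them.\<close>

definition half_odd_harm :: "nat \<Rightarrow> real" where
  "half_odd_harm k = (harm (2 * k) + 1 / (2 * real k + 1) - harm k / 2 - 1) / 2"

lemma half_odd_harm_Suc: "half_odd_harm (Suc k) = half_odd_harm k + 1 / (2 * (2 * real k + 3))"
proof -
  have harm: "harm (2 * Suc k) = harm (2 * k) + 1 / (2 * real k + 1) + 1 / (2 * real k + 2)"
    "harm (Suc k) = harm k + 1 / (real k + 1)"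
    by (simp_all add: harm_Suc inverse_eq_divide add.commute)
  have frac: "1 / (2 * real k + 2) = 1 / (real k + 1) / 2"
    "1 / (2 * real (Suc k) + 1) = 1 / (2 * real k + 3)"
    "1 / (2 * (2 * real k + 3)) = 1 / (2 * real k + 3) / 2"
    by (simp_all add: field_simps)
  define a b c where "a = 1 / (2 * real k + 1)" and "b = 1 / (real k + 1)" and "c = 1 / (2 * real k + 3)"
  show ?thesis
    unfolding half_odd_harm_def harm frac a_def[symmetric] b_def[symmetric] c_def[symmetric]
    by (simp add: field_simps)
qed

text \<open>The odd value follows from the even value at the same \<open>k\<close>, and the next
  even value from the odd one. The floor is \<open>k * (k + 1)\<close> in the first step and
  \<open>(k + 1) ^ 2\<close> in the second.\<close>

lemma miss_average_parity:
  "miss_average (2 * k) = real k ^ 2 / (2 * real k + 1) - half_odd_harm k"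
  "miss_average (2 * k + 1) = real k / 2 - half_odd_harm k"
proof -
  have odd_sq: "(Suc (2 * k)) ^ 2 div 4 = k * (k + 1)" for k :: nat
    by (simp add: power2_eq_square algebra_simps)
  have even_sq: "(Suc (Suc (2 * k))) ^ 2 div 4 = (k + 1) ^ 2" for k :: nat
    by (simp add: power2_eq_square algebra_simps)
  have real_Suc: "real (Suc (2 * k)) = 2 * real k + 1" "real (2 * k + 2) = 2 * real k + 2"
    "real (Suc (Suc (2 * k))) = 2 * real k + 2" "real (Suc (2 * k) + 2) = 2 * real k + 3"
    "real (k * (k + 1)) = real k * (real k + 1)" "real ((k + 1) ^ 2) = (real k + 1) ^ 2" for k
    by (simp_all add: algebra_simps)
  have odd_step: "miss_average (Suc (2 * k)) = miss_average (2 * k)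
      + real k * (real k + 1) / ((2 * real k + 1) * (2 * real k + 2))" for k
    unfolding miss_average_Suc odd_sq real_Suc ..
  have even_step: "miss_average (Suc (Suc (2 * k))) = miss_average (Suc (2 * k))
      + (real k + 1) ^ 2 / ((2 * real k + 2) * (2 * real k + 3))" for k
    unfolding miss_average_Suc[of "Suc (2 * k)"] even_sq real_Suc ..
  have rat1: "x ^ 2 / (2 * x + 1) + x * (x + 1) / ((2 * x + 1) * (2 * x + 2)) = x / 2" if "x \<ge> 0" for x :: real
  proof -
    define y where "y = 2 * x + 1"
    have y: "y > 0" using that by (simp add: y_def)
    have "x * (x + 1) / (y * (2 * x + 2)) = x * (x + 1) / (2 * y * (x + 1))"
      by (simp add: algebra_simps)
    also have "\<dots> = x / (2 * y)" using that by simp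
    finally have "x ^ 2 / y + x * (x + 1) / (y * (2 * x + 2)) = x ^ 2 / y + x / (2 * y)" by simp
    also have "\<dots> = x * (2 * x + 1) / (2 * y)" using y by (simp add: field_simps power2_eq_square)
    also have "\<dots> = x / 2" unfolding y_def[symmetric] using y by simp
    finally show ?thesis unfolding y_def .
  qed
  \<comment> \<open>The subtracted fraction is the increment of \<open>half_odd_harm\<close>; the
    step to an odd index, by contrast, changes the rational part only.\<close>
  have rat2: "x / 2 + (x + 1)^2 / ((2 * x + 2) * (2 * x + 3)) = (x + 1)^2 / (2 * x + 3) - 1 / (2 * (2 * x + 3))" if "x \<ge> 0" for x :: real
  proof -
    define y where "y = 2 * x + 3"
    have y: "y > 0" using that by (simp add: y_def)
    have "(x + 1) ^ 2 / ((2 * x + 2) * y) = (x + 1) * (x + 1) / (2 * y * (x + 1))"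
      by (simp add: algebra_simps power2_eq_square)
    also have "\<dots> = (x + 1) / (2 * y)" using that by simp
    finally have "x / 2 + (x + 1) ^ 2 / ((2 * x + 2) * y) = x / 2 + (x + 1) / (2 * y)" by simp
    also have "\<dots> = (x * y + (x + 1)) / (2 * y)" using y by (simp add: field_simps)
    also have "x * y + (x + 1) = 2 * (x + 1) ^ 2 - 1"
      by (simp add: y_def algebra_simps power2_eq_square)
    also have "(2 * (x + 1) ^ 2 - 1) / (2 * y) = (x + 1) ^ 2 / y - 1 / (2 * y)"
      using y by (simp add: field_simps)
    finally show ?thesis unfolding y_def .
  qed
  have odd: "miss_average (Suc (2 * k)) = real k / 2 - half_odd_harm k"
    if "miss_average (2 * k) = real k ^ 2 / (2 * real k + 1) - half_odd_harm k" for k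
    unfolding odd_step that using rat1[of k] by simp
  show even: "miss_average (2 * k) = real k ^ 2 / (2 * real k + 1) - half_odd_harm k"
  proof (induction k)
    case 0
    then show ?case by (simp add: miss_average_def half_odd_harm_def harm_def)
  next
    case (Suc k)
    have "miss_average (2 * Suc k) = real k / 2 - half_odd_harm k
        + (real k + 1) ^ 2 / ((2 * real k + 2) * (2 * real k + 3))"
      using even_step[of k] odd[OF Suc] by simp
    then show ?case using rat2[of k] by (simp add: half_odd_harm_Suc algebra_simps)
  qed
  show "miss_average (2 * k + 1) = real k / 2 - half_odd_harm k"
    using odd[OF even] by simp
qed

text \<open>\<open>g\<close> and \<open>h\<close> stand for the harmonic numbers of \<open>2k\<close> and \<open>k\<close>, and \<open>x\<close> for \<open>k\<close>.\<close>

definition even_cost :: "real \<Rightarrow> real \<Rightarrow> real \<Rightarrow> real" where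
  "even_cost g h x = 9 / 5 * (2 * x) * g + 1 / 5 * (2 * x) * (h - g) - 89 / 25 * (2 * x)
     + 77 / 40 * g + 3 / 40 * (h - g) + 67 / 800 - 1 / 10
     + (1 / (2 * x - 3) + 3 / (2 * x - 1)) / 320"

text \<open>In terms of \<open>n\<close>, the harmonic number of \<open>n\<close> and
  \<open>h\<close>, this is the formula of \<open>even_cost\<close> with a different parity
  correction. Here \<open>g\<close> belongs to \<open>n - 1\<close>; multiplying its missing
  reciprocal by \<open>n\<close> leaves the constants 9/5 and -1/5.\<close>

definition odd_cost :: "real \<Rightarrow> real \<Rightarrow> real \<Rightarrow> real" where
  "odd_cost g h x = 9 / 5 * (2 * x + 1) * g + 9 / 5 + 1 / 5 * (2 * x + 1) * (h - g) - 1 / 5 - 89 / 25 * (2 * x + 1)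
     + 77 / 40 * (g + 1 / (2 * x + 1)) + 3 / 40 * (h - g - 1 / (2 * x + 1)) + 67 / 800 + 1 / 10
     - (3 / (2 * x - 1) + 1 / (2 * x + 1)) / 320"

text \<open>The recurrence from \<open>2k\<close> and \<open>2k + 1\<close> to
  \<open>2k + 2\<close>, with the harmonic numbers as free variables: only their increments
  matter.\<close>

lemma even_cost_step:
  assumes "x > 3 / 2"
  shows "(2 * x + 2) * (2 * x + 1) * even_cost (g + 1 / (2 * x + 1) + 1 / (2 * x + 2)) (h + 1 / (x + 1)) (x + 1) =
     2 * (2 * x + 1) * (2 * x) * odd_cost g h x - (2 * x - 3) * (2 * x + 2) * even_cost g h x
     + 8 * (2 * x) + 2 + 2 * (x^2 / (2 * x + 1) - (g + 1 / (2 * x + 1) - h / 2 - 1) / 2) + 2 * x^2 / (2 * x + 1)"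
proof -
  \<comment> \<open>Treating the reciprocals as unknowns with one defining relation each makes the
    claim a polynomial identity modulo these relations. The bound on \<open>x\<close> keeps
    \<open>2 * x - 3\<close> nonzero.\<close>
  define a b c d where "a = 1 / (2 * x - 3)" and "b = 1 / (2 * x - 1)" and "c = 1 / (2 * x + 1)" and "d = 1 / (x + 1)"
  have inv: "(2 * x - 3) * a = 1" "(2 * x - 1) * b = 1" "(2 * x + 1) * c = 1" "(x + 1) * d = 1"
    using assms by (simp_all add: a_def b_def c_def d_def)
  have e: "even_cost (g + c + d / 2) (h + d) (x + 1) = 9 / 5 * (2 * (x + 1)) * (g + c + d / 2) + 1 / 5 * (2 * (x + 1)) * (h + d - (g + c + d / 2)) - 89 / 25 * (2 * (x + 1))
     + 77 / 40 * (g + c + d / 2) + 3 / 40 * (h + d - (g + c + d / 2)) + 67 / 800 - 1 / 10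
     + (b + 3 * c) / 320"
    unfolding even_cost_def b_def c_def d_def by (simp add: algebra_simps)
  have e0: "even_cost g h x = 9 / 5 * (2 * x) * g + 1 / 5 * (2 * x) * (h - g) - 89 / 25 * (2 * x)
     + 77 / 40 * g + 3 / 40 * (h - g) + 67 / 800 - 1 / 10
     + (a + 3 * b) / 320"
    by (simp add: even_cost_def a_def b_def)
  have o: "odd_cost g h x = 9 / 5 * (2 * x + 1) * g + 9 / 5 + 1 / 5 * (2 * x + 1) * (h - g) - 1 / 5 - 89 / 25 * (2 * x + 1)
     + 77 / 40 * (g + c) + 3 / 40 * (h - g - c) + 67 / 800 + 1 / 10
     - (3 * b + c) / 320"
    by (simp add: odd_cost_def c_def b_def)
  have d2: "1 / (2 * x + 2) = d / 2" using assms by (simp add: d_def field_simps)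
  have "(2 * x + 2) * (2 * x + 1) * even_cost (g + c + d / 2) (h + d) (x + 1) =
     2 * (2 * x + 1) * (2 * x) * odd_cost g h x - (2 * x - 3) * (2 * x + 2) * even_cost g h x
     + 8 * (2 * x) + 2 + 2 * (x^2 * c - (g + c - h / 2 - 1) / 2) + 2 * x^2 * c"
    unfolding e e0 o using inv by algebra
  moreover have "x^2 / (2 * x + 1) = x^2 * c" "2 * x^2 / (2 * x + 1) = 2 * x^2 * c"
    by (simp_all add: c_def)
  ultimately show ?thesis unfolding d2 by (simp only: c_def[symmetric] d_def[symmetric])
qed

text \<open>The recurrence from \<open>2k + 1\<close> and \<open>2k + 2\<close> to
  \<open>2k + 3\<close>. The quotient with the floor simplifies for odd indices, which gives the
  final summand \<open>x\<close>.\<close>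

lemma odd_cost_step:
  assumes "x > 3 / 2"
  shows "(2 * x + 3) * (2 * x + 2) * odd_cost (g + 1 / (2 * x + 1) + 1 / (2 * x + 2)) (h + 1 / (x + 1)) (x + 1) =
     2 * (2 * x + 2) * (2 * x + 1) * even_cost (g + 1 / (2 * x + 1) + 1 / (2 * x + 2)) (h + 1 / (x + 1)) (x + 1)
     - (2 * x - 2) * (2 * x + 3) * odd_cost g h x
     + 8 * (2 * x + 1) + 2 + 2 * (x / 2 - (g + 1 / (2 * x + 1) - h / 2 - 1) / 2) + x"
proof -
  define a b c d where "a = 1 / (2 * x + 3)" and "b = 1 / (2 * x - 1)" and "c = 1 / (2 * x + 1)" and "d = 1 / (x + 1)"
  have inv: "(2 * x + 3) * a = 1" "(2 * x - 1) * b = 1" "(2 * x + 1) * c = 1" "(x + 1) * d = 1"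
    using assms by (simp_all add: a_def b_def c_def d_def)
  have e: "even_cost (g + c + d / 2) (h + d) (x + 1) = 9 / 5 * (2 * (x + 1)) * (g + c + d / 2) + 1 / 5 * (2 * (x + 1)) * (h + d - (g + c + d / 2)) - 89 / 25 * (2 * (x + 1))
     + 77 / 40 * (g + c + d / 2) + 3 / 40 * (h + d - (g + c + d / 2)) + 67 / 800 - 1 / 10
     + (b + 3 * c) / 320"
    unfolding even_cost_def b_def c_def d_def by (simp add: algebra_simps)
  have o: "odd_cost g h x = 9 / 5 * (2 * x + 1) * g + 9 / 5 + 1 / 5 * (2 * x + 1) * (h - g) - 1 / 5 - 89 / 25 * (2 * x + 1)
     + 77 / 40 * (g + c) + 3 / 40 * (h - g - c) + 67 / 800 + 1 / 10
     - (3 * b + c) / 320"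
    by (simp add: odd_cost_def c_def b_def)
  have o1: "odd_cost (g + c + d / 2) (h + d) (x + 1) = 9 / 5 * (2 * x + 3) * (g + c + d / 2) + 9 / 5 + 1 / 5 * (2 * x + 3) * (h + d - (g + c + d / 2)) - 1 / 5 - 89 / 25 * (2 * x + 3)
     + 77 / 40 * (g + c + d / 2 + a) + 3 / 40 * (h + d - (g + c + d / 2) - a) + 67 / 800 + 1 / 10
     - (3 * c + a) / 320"
    unfolding odd_cost_def c_def a_def d_def by (simp add: algebra_simps)
  have d2: "1 / (2 * x + 2) = d / 2" using assms by (simp add: d_def field_simps)
  have "(2 * x + 3) * (2 * x + 2) * odd_cost (g + c + d / 2) (h + d) (x + 1) =
     2 * (2 * x + 2) * (2 * x + 1) * even_cost (g + c + d / 2) (h + d) (x + 1)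
     - (2 * x - 2) * (2 * x + 3) * odd_cost g h x
     + 8 * (2 * x + 1) + 2 + 2 * (x / 2 - (g + c - h / 2 - 1) / 2) + x"
    unfolding e o o1 using inv by algebra
  then show ?thesis unfolding d2 by (simp only: c_def[symmetric] d_def[symmetric])
qed

text \<open>The closed form yields 23/25 and 59/25 at \<open>n = 2\<close> and \<open>n = 3\<close>
  instead of 1 and 7/3, so the two starting values are taken at 4 and 5.\<close>

lemma mean_comparisons_base:
  "mean_comparisons 4 = 17 / 4" "mean_comparisons 5 = 389 / 60"
proof -
  have "mean_comparisons n = 0" if "n < 2" for n
    unfolding mean_comparisons_def by (rule perm_mean_quicksort_small) (use that in auto)
  then have c01: "mean_comparisons 0 = 0" "mean_comparisons 1 = 0" by simp_all
  have V0: "miss_average 0 = 0" by (simp add: miss_average_def)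
  have V1: "miss_average 1 = 0" using miss_average_parity(2)[of 0] by (simp add: half_odd_harm_def harm_def)
  have V2: "miss_average 2 = 1 / 6" using miss_average_parity(1)[of 1] by (simp add: half_odd_harm_def harm_expand)
  have V3: "miss_average 3 = 1 / 3" using miss_average_parity(2)[of 1] by (simp add: half_odd_harm_def harm_expand)
  have c2: "mean_comparisons 2 = 1" using mean_comparisons_rec[of 0] c01 V0 by (simp add: numeral_2_eq_2)
  have c3: "mean_comparisons 3 = 7 / 3" using mean_comparisons_rec[of 1] c01 c2 V1
    by (simp add: numeral_2_eq_2 numeral_3_eq_3)
  show c4: "mean_comparisons 4 = 17 / 4" using mean_comparisons_rec[of 2] c2 c3 V2 by simp
  show "mean_comparisons 5 = 389 / 60" using mean_comparisons_rec[of 3] c3 c4 V3 by simp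
qed

text \<open>Both parities go through one induction, since each step of the recurrence needs the two
  preceding values; the odd step already uses the new even value.\<close>

lemma mean_comparisons_closed:
  assumes "k \<ge> 2"
  shows "mean_comparisons (2 * k) = even_cost (harm (2 * k)) (harm k) (real k)
    \<and> mean_comparisons (2 * k + 1) = odd_cost (harm (2 * k)) (harm k) (real k)"
  using assms
proof (induction k rule: dec_induct)
  case base
  show ?case by (simp add: mean_comparisons_base even_cost_def odd_cost_def harm_expand)
next
  case (step k)
  define x g h where "x = real k" and "g = (harm (2 * k) :: real)" and "h = (harm k :: real)"
  have x: "x > 3 / 2" using step by (simp add: x_def)
  have harm: "harm (2 * Suc k) = g + 1 / (2 * x + 1) + 1 / (2 * x + 2)" "harm (Suc k) = h + 1 / (x + 1)"
    by (simp_all add: harm_Suc inverse_eq_divide add.commute x_def g_def h_def)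
  have odd_sq: "(2 * k + 1) ^ 2 div 4 = k * (k + 1)"
    by (simp add: power2_eq_square algebra_simps)
  have even_sq: "(2 * k) ^ 2 div 4 = k ^ 2" by (simp add: power2_eq_square)
  have V: "miss_average (2 * k) = x ^ 2 / (2 * x + 1) - (g + 1 / (2 * x + 1) - h / 2 - 1) / 2"
    "miss_average (2 * k + 1) = x / 2 - (g + 1 / (2 * x + 1) - h / 2 - 1) / 2"
    using miss_average_parity[of k] by (simp_all only: half_odd_harm_def x_def g_def h_def)
  note IH = step.IH[folded x_def g_def h_def]
  let ?e = "even_cost (g + 1 / (2 * x + 1) + 1 / (2 * x + 2)) (h + 1 / (x + 1)) (x + 1)"
  let ?o = "odd_cost (g + 1 / (2 * x + 1) + 1 / (2 * x + 2)) (h + 1 / (x + 1)) (x + 1)"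
  have real_k: "real (2 * k) = 2 * x" "real (2 * k + 1) = 2 * x + 1" "real (2 * k + 2) = 2 * x + 2"
    "real (2 * k + 1 + 1) = 2 * x + 2" "real (2 * k + 1 + 2) = 2 * x + 3"
    "real (k ^ 2) = x ^ 2" "real (k * (k + 1)) = x * (x + 1)"
    by (simp_all add: x_def algebra_simps)
  have "(2 * x + 2) * (2 * x + 1) * mean_comparisons (2 * k + 2) = (2 * x + 2) * (2 * x + 1) * ?e"
    unfolding even_cost_step[OF x]
    using mean_comparisons_rec[of "2 * k", unfolded even_sq real_k] IH V(1) by simp
  then have e: "mean_comparisons (2 * k + 2) = ?e" using x by simp
  have "(2 * x + 2) * x = 2 * (x * (x + 1))" by (simp add: algebra_simps)
  then have div: "2 * (x * (x + 1)) / (2 * x + 2) = x" using x by (simp add: divide_eq_eq mult.commute)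
  have "2 * k + 1 + 1 = 2 * k + 2" "2 * x + 1 - 3 = 2 * x - 2" by simp_all
  then have "(2 * x + 3) * (2 * x + 2) * mean_comparisons (2 * k + 1 + 2) = (2 * x + 3) * (2 * x + 2) * ?o"
    unfolding odd_cost_step[OF x] e[symmetric]
    using mean_comparisons_rec[of "2 * k + 1", unfolded odd_sq real_k div] IH V(2) by simp
  then have o: "mean_comparisons (2 * k + 1 + 2) = ?o" using x by simp
  have "2 * Suc k = 2 * k + 2" "2 * k + 2 + 1 = 2 * k + 1 + 2" "real (Suc k) = x + 1"
    by (simp_all add: x_def)
  then show ?case using e o harm by (simp only:)
qed

section \<open>Bounds on harmonic numbers\<close>

lemma nondecreasing_tendsto_0_imp_nonpos:
  fixes g :: "real \<Rightarrow> real"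
  assumes deriv: "\<And>x. x > 0 \<Longrightarrow> (g has_real_derivative g' x) (at x)"
    and nonneg: "\<And>x. x > 0 \<Longrightarrow> g' x \<ge> 0"
    and lim: "(g \<longlongrightarrow> 0) at_top" and "x > 0"
  shows "g x \<le> 0"
proof (rule tendsto_lowerbound[OF lim])
  have "g x \<le> g y" if "x \<le> y" for y
    by (rule DERIV_nonneg_imp_nondecreasing[OF that])
      (metis assms(1,2) \<open>x > 0\<close> less_le_trans)
  then show "eventually (\<lambda>y. g x \<le> g y) at_top"
    using eventually_ge_at_top by (rule eventually_mono[rotated])
qed simp

text \<open>Consecutive truncations of the Euler--Maclaurin series, without the constant.\<close>

definition harm_lower :: "real \<Rightarrow> real" where
  "harm_lower x = ln x + 1 / (2 * x) - 1 / (12 * x ^ 2) + 1 / (120 * x ^ 4) - 1 / (252 * x ^ 6)"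

definition harm_upper :: "real \<Rightarrow> real" where
  "harm_upper x = harm_lower x + 1 / (240 * x ^ 8)"

lemma has_real_derivative_inverse_power:
  fixes c x :: real
  assumes "x \<noteq> 0" "c \<noteq> 0"
  shows "((\<lambda>x. 1 / (c * x ^ n)) has_real_derivative - real n / (c * x ^ Suc n)) (at x)"
  apply (rule derivative_eq_intros refl | use assms in \<open>simp; fail\<close>)+
  using assms by (cases n) (simp_all add: field_simps)

definition harm_lower_deriv :: "real \<Rightarrow> real" where
  "harm_lower_deriv x = 1 / x - 1 / (2 * x ^ 2) + 1 / (6 * x ^ 3) - 1 / (30 * x ^ 5) + 1 / (42 * x ^ 7)"

lemma has_real_derivative_harm_lower:
  "x > 0 \<Longrightarrow> (harm_lower has_real_derivative harm_lower_deriv x) (at x)"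
  unfolding harm_lower_def
  apply (rule DERIV_cong)
   apply (rule DERIV_diff DERIV_add DERIV_ln_divide has_real_derivative_inverse_power[where n=1, simplified] has_real_derivative_inverse_power | simp; fail)+
  apply (simp_all add: harm_lower_deriv_def eval_nat_numeral)
  done

lemma has_real_derivative_harm_upper:
  "x > 0 \<Longrightarrow> (harm_upper has_real_derivative harm_lower_deriv x - 1 / (30 * x ^ 9)) (at x)"
  unfolding harm_upper_def
  apply (rule DERIV_cong)
   apply (rule DERIV_add has_real_derivative_harm_lower has_real_derivative_inverse_power | simp; fail)+
  done

text \<open>Here \<open>X\<close> and \<open>Y\<close> stand for high powers that are kept as atoms,
  so that only the numerator remains to be computed.\<close>

lemma diff_fracs_common:
  fixes X Y c :: "'a::field"
  assumes "X \<noteq> 0" "Y \<noteq> 0" "c \<noteq> 0"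
  shows "- (a / Y) - (p / (c * Y) - q / (c * X)) = (- c * (X * a) - (p * X - q * Y)) / (c * (X * Y))"
  using assms by (simp add: field_simps)

text \<open>Over the common denominator all coefficients of the numerator are positive, which shows
  the sign for every positive \<open>x\<close>. The next term of the series reverses it in
  \<open>harm_upper_deriv_diff\<close>.\<close>

lemma harm_lower_deriv_diff:
  assumes "x > (0::real)"
  shows "- (1 / (x+1)^2) - (harm_lower_deriv (x + 1) - harm_lower_deriv x)
    = (5 + 35*x + 98*x^2 + 126*x^3 + 63*x^4) / (210 * (x^7 * (x+1)^7))" (is "?l = ?r / ?d")
proof -
  have y: "x + 1 > 0" using assms by simp
  define P where "P = (\<lambda>x::real. 210*x^6 - 105*x^5 + 35*x^4 - 7*x^2 + 5)"
  have P: "harm_lower_deriv x = P x / (210 * x^7)" if "x > 0" for x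
    using that unfolding P_def harm_lower_deriv_def
    by (simp add: add_divide_distrib diff_divide_distrib power_eq_if)
  have "1 / (x+1)^2 = (x+1)^5 / (x+1)^7"
    using y by (simp add: divide_eq_eq flip: power_add)
  then have "?l = - ((x+1)^5 / (x+1)^7) - (P (x+1) / (210 * (x+1)^7) - P x / (210 * x^7))"
    using P[OF assms] P[OF y] by simp
  also have "\<dots> = (- 210 * (x^7*(x+1)^5) - (P (x+1) * x^7 - P x * (x+1)^7)) / ?d"
    using assms y by (subst diff_fracs_common) simp_all
  also have "- 210 * (x^7*(x+1)^5) - (P (x+1) * x^7 - P x * (x+1)^7) = ?r"
    unfolding P_def by algebra
  finally show ?thesis .
qed

lemma harm_upper_deriv_diff:
  assumes "x > (0::real)"
  shows "- (1 / (x+1)^2) - ((harm_lower_deriv (x + 1) - 1 / (30*(x+1)^9)) - (harm_lower_deriv x - 1 / (30 * x^9)))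
    = - (42 + 378*x + 1482*x^2 + 3258*x^3 + 4254*x^4 + 3150*x^5 + 1050*x^6) / (1260 * (x^9 * (x+1)^9))"
    (is "?l = - ?r / ?d")
proof -
  have y: "x + 1 > 0" using assms by simp
  define P where "P = (\<lambda>x::real. 1260*x^8 - 630*x^7 + 210*x^6 - 42*x^4 + 30*x^2 - 42)"
  have P: "harm_lower_deriv x - 1 / (30 * x^9) = P x / (1260 * x^9)" if "x > 0" for x
    using that unfolding P_def harm_lower_deriv_def
    by (simp add: add_divide_distrib diff_divide_distrib power_eq_if)
  have "1 / (x+1)^2 = (x+1)^7 / (x+1)^9"
    using y by (simp add: divide_eq_eq flip: power_add)
  then have "?l = - ((x+1)^7 / (x+1)^9) - (P (x+1) / (1260 * (x+1)^9) - P x / (1260 * x^9))"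
    using P[OF assms] P[OF y] by simp
  also have "\<dots> = (- 1260 * (x^9*(x+1)^7) - (P (x+1) * x^9 - P x * (x+1)^9)) / ?d"
    using assms y by (subst diff_fracs_common) simp_all
  also have "- 1260 * (x^9*(x+1)^7) - (P (x+1) * x^9 - P x * (x+1)^9) = - ?r"
    unfolding P_def by algebra
  finally show ?thesis .
qed

text \<open>The error of one step tends to 0, so its sign follows from that of its derivative, where
  the logarithms have become rational. The factor \<open>c\<close> is 1 or -1 and selects the
  direction.\<close>

lemma step_le_of_deriv:
  fixes F :: "real \<Rightarrow> real"
  assumes deriv: "\<And>x. x > 0 \<Longrightarrow> (F has_real_derivative F' x) (at x)"
    and nonneg: "\<And>x. x > 0 \<Longrightarrow> c * (- (1 / (x + 1)^2) - (F' (x + 1) - F' x)) \<ge> 0"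
    and lim: "((\<lambda>x. c * (1 / (x + 1) - (F (x + 1) - F x))) \<longlongrightarrow> 0) at_top" and "x > 0"
  shows "c * (1 / (x + 1) - (F (x + 1) - F x)) \<le> 0"
proof (rule nondecreasing_tendsto_0_imp_nonpos[OF _ nonneg lim \<open>x > 0\<close>])
  fix x :: real assume x: "x > 0"
  have 1: "((\<lambda>x. 1 / (x + 1)) has_real_derivative - (1 / (x + 1)^2)) (at x)"
    using has_real_derivative_inverse_power[of "x + 1" 1 1] x
    unfolding DERIV_shift by (simp add: power2_eq_square)
  have 2: "((\<lambda>x. F (x + 1)) has_real_derivative F' (x + 1)) (at x)"
    using deriv[of "x + 1"] x unfolding DERIV_shift by simp
  show "((\<lambda>x. c * (1 / (x + 1) - (F (x + 1) - F x))) has_real_derivative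
      c * (- (1 / (x + 1)^2) - (F' (x + 1) - F' x))) (at x)"
    by (intro DERIV_cmult DERIV_diff 1 2 deriv x)
qed

lemma harm_lower_step:
  assumes "x > 0"
  shows "1 / (x + 1) \<le> harm_lower (x + 1) - harm_lower x"
proof -
  have "1 * (1 / (x + 1) - (harm_lower (x + 1) - harm_lower x)) \<le> 0"
  proof (rule step_le_of_deriv[OF has_real_derivative_harm_lower _ _ assms])
    fix x :: real assume x: "x > 0"
    show "1 * (- (1 / (x + 1)^2) - (harm_lower_deriv (x + 1) - harm_lower_deriv x)) \<ge> 0"
      unfolding harm_lower_deriv_diff[OF x] using x by simp
  next
    show "((\<lambda>x. 1 * (1 / (x + 1) - (harm_lower (x + 1) - harm_lower x))) \<longlongrightarrow> 0) at_top"
      unfolding harm_lower_def by real_asymp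
  qed
  then show ?thesis by simp
qed

lemma harm_upper_step:
  assumes "x > 0"
  shows "harm_upper (x + 1) - harm_upper x \<le> 1 / (x + 1)"
proof -
  have "(-1) * (1 / (x + 1) - (harm_upper (x + 1) - harm_upper x)) \<le> 0"
  proof (rule step_le_of_deriv[OF has_real_derivative_harm_upper _ _ assms])
    fix x :: real assume x: "x > 0"
    show "(-1) * (- (1 / (x + 1)^2) - ((harm_lower_deriv (x + 1) - 1 / (30*(x+1)^9))
        - (harm_lower_deriv x - 1 / (30 * x^9)))) \<ge> 0"
      unfolding harm_upper_deriv_diff[OF x] minus_divide_left[symmetric] mult_minus1 minus_minus using x
      by (intro divide_nonneg_pos) simp_all
  next
    show "((\<lambda>x. (-1) * (1 / (x + 1) - (harm_upper (x + 1) - harm_upper x))) \<longlongrightarrow> 0) at_top"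
      unfolding harm_upper_def harm_lower_def by real_asymp
  qed
  then show ?thesis by simp
qed

text \<open>By the step inequalities, \<open>harm n - harm_lower n\<close> decreases and
  \<open>harm n - harm_upper n\<close> increases weakly. Both tend to
  \<open>euler_mascheroni\<close>, so every term bounds it.\<close>

lemma harm_bounds:
  assumes "n > 0"
  shows "euler_mascheroni \<le> harm n - harm_lower n" "harm n - harm_upper n \<le> euler_mascheroni"
proof -
  have lim: "(\<lambda>n. harm n - harm_lower n) \<longlonglongrightarrow> euler_mascheroni"
    "(\<lambda>n. harm n - harm_upper n) \<longlonglongrightarrow> euler_mascheroni"
  proof -
    have "(\<lambda>n::nat. ln n - harm_lower n) \<longlonglongrightarrow> 0" "(\<lambda>n::nat. ln n - harm_upper n) \<longlonglongrightarrow> 0"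
      unfolding harm_upper_def harm_lower_def by real_asymp+
    from this[THEN tendsto_add[OF euler_mascheroni_LIMSEQ]]
    show "(\<lambda>n. harm n - harm_lower n) \<longlonglongrightarrow> euler_mascheroni"
      "(\<lambda>n. harm n - harm_upper n) \<longlonglongrightarrow> euler_mascheroni" by simp_all
  qed
  have harm_step: "harm (Suc m) - harm_lower (real (Suc m)) \<le> harm m - harm_lower (real m)"
    "harm m - harm_upper (real m) \<le> harm (Suc m) - harm_upper (real (Suc m))" if "m > 0" for m
    using harm_lower_step[of m] harm_upper_step[of m] that
    by (simp_all add: harm_Suc inverse_eq_divide add.commute)
  have "harm m - harm_lower m \<le> harm n - harm_lower n \<and> harm n - harm_upper n \<le> harm m - harm_upper m"
    if "n \<le> m" for m
    using that
  proof (induction m rule: dec_induct)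
    case (step m)
    with assms harm_step[of m] show ?case by linarith
  qed simp
  then have ev: "\<forall>\<^sub>F m in sequentially. harm m - harm_lower m \<le> harm n - harm_lower n"
    "\<forall>\<^sub>F m in sequentially. harm n - harm_upper n \<le> harm m - harm_upper m"
    by (auto intro!: eventually_sequentiallyI[of n])
  show "euler_mascheroni \<le> harm n - harm_lower n"
    by (rule tendsto_upperbound[OF lim(1) ev(1)]) simp
  show "harm n - harm_upper n \<le> euler_mascheroni"
    by (rule tendsto_lowerbound[OF lim(2) ev(2)]) simp
qed

section \<open>Numerical bounds for the constants\<close>

lemma ln_2_bounds: "ln (2::real) \<in> {0.69314718055994530941..0.69314718055994530942}"
proof -
  \<comment> \<open>The series of 2 artanh(1/3), which equals ln 2, cut after twenty terms; the tail
    is at most \<open>2 * d\<close>, small enough for twenty decimals.\<close>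
  define S where "S = (\<Sum>k<20. 2 * (1 / 3 :: real) ^ (2 * k + 1) / real (2 * k + 1))"
  define d where "d = (1 / 3 :: real) ^ (2 * 20 + 1) / (1 - (1 / 3)^2) / real (2 * 20 + 1)"
  have third: "(2 - 1) / (2 + 1) = (1 / 3 :: real)" by simp
  have "ln 2 \<in> {S..S + 2 * d}"
    unfolding S_def d_def using ln_approx_bounds[of "2::real" 20, unfolded third]
    by simp
  moreover have "S \<in> {0.69314718055994530941..0.693147180559945309416}"
    unfolding S_def by (simp add: lessThan_nat_numeral power_divide)
  moreover have "2 * d \<le> 2 / 10 ^ 21"
    unfolding d_def by (simp add: power_divide)
  ultimately show ?thesis by simp
qed

lemma harm_64: "harm 64 = (623171679694215690971693339 / 131362987122535807501262400::real)"
  by (simp add: harm_expand)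

text \<open>The index 64 is a power of two, so only ln 2 is needed, and the gap 1/(240 * 64^8)
  between the two bounds is below 2/10^17.\<close>

lemma euler_mascheroni_bounds_16:
  "euler_mascheroni \<in> {0.5772156649015328..(0.5772156649015330::real)}"
proof -
  have "ln (64::real) = 6 * ln 2" using ln_realpow[of 2 6] by simp
  then have "harm_lower 64 = 6 * ln 2 + (1 / 128 - 1 / 49152 + 1 / 2013265920 - 1 / 17317308137472)"
    "harm_upper 64 = harm_lower 64 + 1 / 67553994410557440"
    unfolding harm_upper_def harm_lower_def by simp_all
  then show ?thesis
    using harm_bounds[of 64] ln_2_bounds unfolding harm_64 by simp
qed

section \<open>Asymptotic expansion\<close>

text \<open>The cut before the sixth power suffices: harmonic numbers enter the cost with at most
  linear coefficients, so an error of order 6 becomes one of order 5.\<close>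

definition harm_tail :: "real \<Rightarrow> real" where
  "harm_tail x = 1 / (2 * x) - 1 / (12 * x ^ 2) + 1 / (120 * x ^ 4)"

definition harm_approx :: "real \<Rightarrow> real" where
  "harm_approx x = ln x + euler_mascheroni + harm_tail x"

text \<open>Up to the constant, \<open>harm_approx\<close> exceeds \<open>harm_lower\<close> by
  1/(252 n^6), and \<open>harm_upper\<close> lies only 1/(240 n^8) above
  \<open>harm_lower\<close>.\<close>

lemma harm_approx_error: "(\<lambda>n. harm n - harm_approx (real n)) \<in> O(\<lambda>n. 1 / real n ^ 6)"
proof (rule bigoI[where c = 1], rule eventually_sequentiallyI[of 1])
  fix n :: nat assume "n \<ge> 1"
  then have n: "n > 0" by simp
  define u v H G where "u = 1 / real n ^ 6" and "v = 1 / real n ^ 8"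
    and "H = (harm n :: real)" and "G = harm_approx (real n)"
  have "v \<le> u"
    unfolding u_def v_def using n by (intro divide_left_mono power_increasing) auto
  moreover have "u \<ge> 0" "v \<ge> 0" by (simp_all add: u_def v_def)
  moreover have lower: "harm_lower (real n) = G - euler_mascheroni - u / 252"
    by (simp add: harm_lower_def harm_approx_def harm_tail_def u_def G_def)
  moreover have "harm_upper (real n) = G - euler_mascheroni - u / 252 + v / 240"
    unfolding harm_upper_def lower by (simp add: v_def)
  ultimately have "\<bar>H - G\<bar> \<le> u"
    using harm_bounds[OF n, folded H_def] by (simp add: abs_le_iff)
  then show "norm (harm n - harm_approx (real n)) \<le> 1 * norm (1 / real n ^ 6)"
    by (simp add: u_def H_def G_def)
qed

text \<open>The parity indicator becomes a real parameter, so that on each parity class the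
  expansion is a fixed elementary function of a real variable.\<close>

definition cost_expansion :: "real \<Rightarrow> real \<Rightarrow> real" where
  "cost_expansion \<delta> x = 9 / 5 * x * ln x
     + (9 / 5 * euler_mascheroni - 1 / 5 * ln 2 - 89 / 25) * x + 77 / 40 * ln x
     + (77 / 40 * euler_mascheroni - 3 / 40 * ln 2 + 787 / 800)
     + 13 / 16 / x + (- 77 / 480) / x ^ 2 + (1 / 8 * \<delta> + (- 19 / 400)) / x ^ 3"

lemma ln_double: "x > 0 \<Longrightarrow> ln (2 * x) = ln 2 + ln (x :: real)"
  by (simp add: ln_mult)

text \<open>All logarithms and the Euler-Mascheroni constant cancel identically; the remainder
  \<open>R\<close> is a rational function whose order can be read off.\<close>

lemma even_cost_expansion:
  "(\<lambda>k. even_cost (harm_approx (2 * real k)) (harm_approx (real k)) (real k)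
      - cost_expansion 1 (2 * real k)) \<in> O(\<lambda>k. 1 / real k ^ 4)"
proof -
  define R where "R = (\<lambda>x::real. (16 / 5 * x + 37 / 20) * harm_tail (2 * x)
      + (2 / 5 * x + 3 / 40) * harm_tail x - 1
      + (1 / (2 * x - 3) + 3 / (2 * x - 1)) / 320 - 13 / 16 / (2 * x) + 77 / 480 / (2 * x) ^ 2
      - 31 / 400 / (2 * x) ^ 3)"
  have eq: "even_cost (harm_approx (2 * x)) (harm_approx x) x - cost_expansion 1 (2 * x) = R x"
    if "x > 0" for x
    unfolding even_cost_def harm_approx_def cost_expansion_def R_def ln_double[OF that]
    by algebra
  have "(\<lambda>k. R (real k)) \<in> O(\<lambda>k. 1 / real k ^ 4)"
    unfolding R_def harm_tail_def by real_asymp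
  then show ?thesis
    by (rule landau_o.big.ev_eq_trans2[where g = "\<lambda>_ y. y", rotated])
      (auto intro!: eventually_sequentiallyI[of 1] eq)
qed

text \<open>The expansion is taken at \<open>2 * x + 1\<close> but \<open>harm_approx\<close> at
  \<open>2 * x\<close>, so \<open>ln (1 + 1 / (2 * x))\<close> survives in the remainder and is
  expanded there.\<close>

lemma odd_cost_expansion:
  "(\<lambda>k. odd_cost (harm_approx (2 * real k)) (harm_approx (real k)) (real k)
      - cost_expansion 0 (2 * real k + 1)) \<in> O(\<lambda>k. 1 / real k ^ 4)"
proof -
  define R where "R = (\<lambda>x::real. (9 / 5 * (2 * x + 1) + 77 / 40) * (harm_tail (2 * x) - ln (1 + 1 / (2 * x)))
      + (1 / 5 * (2 * x + 1) + 3 / 40) * (harm_tail x - harm_tail (2 * x)) + 37 / 20 / (2 * x + 1) + 4 / 5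
      - (3 / (2 * x - 1) + 1 / (2 * x + 1)) / 320 - 13 / 16 / (2 * x + 1) + 77 / 480 / (2 * x + 1) ^ 2
      + 19 / 400 / (2 * x + 1) ^ 3)"
  have eq: "odd_cost (harm_approx (2 * x)) (harm_approx x) x - cost_expansion 0 (2 * x + 1) = R x"
    if "x > 0" for x
  proof -
    have "2 * x + 1 = (2 * x) * (1 + 1 / (2 * x))" using that by (simp add: distrib_left)
    then have "ln (2 * x + 1) = ln ((2 * x) * (1 + 1 / (2 * x)))" by (rule arg_cong)
    also have "\<dots> = ln (2 * x) + ln (1 + 1 / (2 * x))"
      using that by (intro ln_mult_pos) (auto intro: add_pos_pos)
    finally have ln: "ln (2 * x + 1) = ln 2 + ln x + ln (1 + 1 / (2 * x))"
      using ln_double[OF that] by simp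
    show ?thesis
      unfolding odd_cost_def harm_approx_def cost_expansion_def R_def ln ln_double[OF that]
      by algebra
  qed
  have "(\<lambda>k. R (real k)) \<in> O(\<lambda>k. 1 / real k ^ 4)"
    unfolding R_def harm_tail_def by real_asymp
  then show ?thesis
    by (rule landau_o.big.ev_eq_trans2[where g = "\<lambda>_ y. y", rotated])
      (auto intro!: eventually_sequentiallyI[of 1] eq)
qed

section \<open>Transfer of the expansion to the mean\<close>

lemma bigo_even_oddI:
  fixes f g :: "nat \<Rightarrow> real"
  assumes "(\<lambda>k. f (2 * k)) \<in> O(\<lambda>k. g (2 * k))" "(\<lambda>k. f (2 * k + 1)) \<in> O(\<lambda>k. g (2 * k + 1))"
  shows "f \<in> O(g)"
proof -
  obtain c where c: "c > 0" "\<forall>\<^sub>F k in sequentially. norm (f (2 * k)) \<le> c * norm (g (2 * k))"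
    using landau_o.bigE[OF assms(1)] by blast
  obtain d where d: "d > 0" "\<forall>\<^sub>F k in sequentially. norm (f (2 * k + 1)) \<le> d * norm (g (2 * k + 1))"
    using landau_o.bigE[OF assms(2)] by blast
  have "\<forall>\<^sub>F k in sequentially. norm (f (2 * k)) \<le> c * norm (g (2 * k))
      \<and> norm (f (2 * k + 1)) \<le> d * norm (g (2 * k + 1))"
    using c(2) d(2) by (rule eventually_conj)
  then obtain N where N: "\<And>k. k \<ge> N \<Longrightarrow> norm (f (2 * k)) \<le> c * norm (g (2 * k))
      \<and> norm (f (2 * k + 1)) \<le> d * norm (g (2 * k + 1))"
    unfolding eventually_sequentially by blast
  have "norm (f n) \<le> max c d * norm (g n)" if "n \<ge> 2 * N" for n
  proof -
    define k where "k = n div 2"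
    have k: "k \<ge> N" using that by (simp add: k_def)
    have "n = 2 * k \<or> n = 2 * k + 1" unfolding k_def by presburger
    then have "norm (f n) \<le> c * norm (g n) \<or> norm (f n) \<le> d * norm (g n)"
      using N[OF k] by (elim disjE) simp_all
    moreover have "c * norm (g n) \<le> max c d * norm (g n)" "d * norm (g n) \<le> max c d * norm (g n)"
      by (simp_all add: mult_right_mono)
    ultimately show ?thesis by linarith
  qed
  then show ?thesis by (intro bigoI[where c = "max c d"] eventually_sequentiallyI)
qed

text \<open>Linear coefficients times errors of order 6 give order 5, so harmonic numbers may be
  replaced by \<open>harm_approx\<close>.\<close>

lemma harm_perturbation:
  assumes "p \<in> O(\<lambda>k. real k)" "q \<in> O(\<lambda>k. real k)"
  shows "(\<lambda>k. p k * (harm (2 * k) - harm_approx (2 * real k)) + q k * (harm k - harm_approx (real k)))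
    \<in> O(\<lambda>k. 1 / real k ^ 4)"
proof -
  have "filterlim (\<lambda>k::nat. 2 * k) sequentially sequentially"
    by (rule filterlim_subseq) (simp add: strict_mono_def)
  from landau_o.big.compose[OF harm_approx_error this]
  have "(\<lambda>k. harm (2 * k) - harm_approx (2 * real k)) \<in> O(\<lambda>k. 1 / (2 * real k) ^ 6)" by simp
  also have "(\<lambda>k. 1 / (2 * real k) ^ 6) \<in> O(\<lambda>k. 1 / real k ^ 6)" by real_asymp
  finally have "(\<lambda>k. p k * (harm (2 * k) - harm_approx (2 * real k)) + q k * (harm k - harm_approx (real k)))
      \<in> O(\<lambda>k. real k * (1 / real k ^ 6))"
    by (intro sum_in_bigo(1)[OF landau_o.big.mult landau_o.big.mult] assms harm_approx_error)
  also have "(\<lambda>k. real k * (1 / real k ^ 6)) \<in> O(\<lambda>k. 1 / real k ^ 4)" by real_asymp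
  finally show ?thesis .
qed

text \<open>The cost is affine in \<open>g\<close> and \<open>h\<close>; the factors of the
  differences are its slopes.\<close>

lemma even_cost_perturb:
  "even_cost g h x = ((16 / 5 * x + 37 / 20) * (g - g') + (2 / 5 * x + 3 / 40) * (h - h')) + even_cost g' h' x"
  unfolding even_cost_def by algebra

lemma odd_cost_perturb:
  "odd_cost g h x = ((16 / 5 * x + 69 / 20) * (g - g') + (2 / 5 * x + 11 / 40) * (h - h')) + odd_cost g' h' x"
  unfolding odd_cost_def by algebra

lemma mean_comparisons_even_expansion:
  "(\<lambda>k. mean_comparisons (2 * k) - cost_expansion 1 (2 * real k)) \<in> O(\<lambda>k. 1 / real k ^ 4)"
proof (rule landau_o.big.ev_eq_trans2[where g = "\<lambda>_ y. y"])
  have "(\<lambda>k. 16 / 5 * real k + 37 / 20) \<in> O(\<lambda>k. real k)" "(\<lambda>k. 2 / 5 * real k + 3 / 40) \<in> O(\<lambda>k. real k)"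
    by real_asymp+
  from sum_in_bigo(1)[OF harm_perturbation[OF this] even_cost_expansion]
  show "(\<lambda>k. ((16 / 5 * real k + 37 / 20) * (harm (2 * k) - harm_approx (2 * real k))
        + (2 / 5 * real k + 3 / 40) * (harm k - harm_approx (real k)))
      + (even_cost (harm_approx (2 * real k)) (harm_approx (real k)) (real k) - cost_expansion 1 (2 * real k)))
    \<in> O(\<lambda>k. 1 / real k ^ 4)" .
  show "\<forall>\<^sub>F k in sequentially. mean_comparisons (2 * k) - cost_expansion 1 (2 * real k) =
     ((16 / 5 * real k + 37 / 20) * (harm (2 * k) - harm_approx (2 * real k))
        + (2 / 5 * real k + 3 / 40) * (harm k - harm_approx (real k)))
      + (even_cost (harm_approx (2 * real k)) (harm_approx (real k)) (real k) - cost_expansion 1 (2 * real k))"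
  proof (rule eventually_sequentiallyI[of 2])
    fix k :: nat assume "k \<ge> 2"
    from mean_comparisons_closed[OF this, THEN conjunct1]
      even_cost_perturb[of "harm (2 * k)" "harm k" "real k" "harm_approx (2 * real k)" "harm_approx (real k)"]
    show "mean_comparisons (2 * k) - cost_expansion 1 (2 * real k) =
     ((16 / 5 * real k + 37 / 20) * (harm (2 * k) - harm_approx (2 * real k))
        + (2 / 5 * real k + 3 / 40) * (harm k - harm_approx (real k)))
      + (even_cost (harm_approx (2 * real k)) (harm_approx (real k)) (real k) - cost_expansion 1 (2 * real k))"
      by simp
  qed
qed

lemma mean_comparisons_odd_expansion:
  "(\<lambda>k. mean_comparisons (2 * k + 1) - cost_expansion 0 (2 * real k + 1)) \<in> O(\<lambda>k. 1 / real k ^ 4)"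
proof (rule landau_o.big.ev_eq_trans2[where g = "\<lambda>_ y. y"])
  have "(\<lambda>k. 16 / 5 * real k + 69 / 20) \<in> O(\<lambda>k. real k)" "(\<lambda>k. 2 / 5 * real k + 11 / 40) \<in> O(\<lambda>k. real k)"
    by real_asymp+
  from sum_in_bigo(1)[OF harm_perturbation[OF this] odd_cost_expansion]
  show "(\<lambda>k. ((16 / 5 * real k + 69 / 20) * (harm (2 * k) - harm_approx (2 * real k))
        + (2 / 5 * real k + 11 / 40) * (harm k - harm_approx (real k)))
      + (odd_cost (harm_approx (2 * real k)) (harm_approx (real k)) (real k) - cost_expansion 0 (2 * real k + 1)))
    \<in> O(\<lambda>k. 1 / real k ^ 4)" .
  show "\<forall>\<^sub>F k in sequentially. mean_comparisons (2 * k + 1) - cost_expansion 0 (2 * real k + 1) =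
     ((16 / 5 * real k + 69 / 20) * (harm (2 * k) - harm_approx (2 * real k))
        + (2 / 5 * real k + 11 / 40) * (harm k - harm_approx (real k)))
      + (odd_cost (harm_approx (2 * real k)) (harm_approx (real k)) (real k) - cost_expansion 0 (2 * real k + 1))"
  proof (rule eventually_sequentiallyI[of 2])
    fix k :: nat assume "k \<ge> 2"
    from mean_comparisons_closed[OF this, THEN conjunct2]
      odd_cost_perturb[of "harm (2 * k)" "harm k" "real k" "harm_approx (2 * real k)" "harm_approx (real k)"]
    show "mean_comparisons (2 * k + 1) - cost_expansion 0 (2 * real k + 1) =
     ((16 / 5 * real k + 69 / 20) * (harm (2 * k) - harm_approx (2 * real k))
        + (2 / 5 * real k + 11 / 40) * (harm k - harm_approx (real k)))
      + (odd_cost (harm_approx (2 * real k)) (harm_approx (real k)) (real k) - cost_expansion 0 (2 * real k + 1))"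
      by simp
  qed
qed

lemma mean_comparisons_expansion:
  "(\<lambda>n. mean_comparisons n - cost_expansion (of_bool (even n)) (real n)) \<in> O(\<lambda>n. 1 / real n ^ 4)"
proof (rule bigo_even_oddI)
  have "(\<lambda>k. 1 / real k ^ 4) \<in> O(\<lambda>k. 1 / (2 * real k) ^ 4)" by real_asymp
  from landau_o.big_trans[OF mean_comparisons_even_expansion this]
  show "(\<lambda>k. mean_comparisons (2 * k) - cost_expansion (of_bool (even (2 * k))) (real (2 * k)))
      \<in> O(\<lambda>k. 1 / real (2 * k) ^ 4)" by simp
  have "(\<lambda>k. 1 / real k ^ 4) \<in> O(\<lambda>k. 1 / (2 * real k + 1) ^ 4)" by real_asymp
  from landau_o.big_trans[OF mean_comparisons_odd_expansion this]
  show "(\<lambda>k. mean_comparisons (2 * k + 1) - cost_expansion (of_bool (even (2 * k + 1))) (real (2 * k + 1)))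
      \<in> O(\<lambda>k. 1 / real (2 * k + 1) ^ 4)" by (simp add: add.commute)
qed

theorem corollary10p2:
  fixes A B C D E F G :: real
  assumes "A = 9 / 5 * euler_mascheroni - 1 / 5 * ln 2 - 89 / 25"
    and "B = 77 / 40"
    and "C = 77 / 40 * euler_mascheroni - 3 / 40 * ln 2 + 787 / 800"
    and "D = 13 / 16"
    and "E = - 77 / 480"
    and "F = 1 / 8"
    and "G = - 19 / 400"
  shows "(\<lambda>n. measure_pmf.expectation (clairvoyant_comparisons_pmf n) real
            - (9 / 5 * real n * ln (real n) + A * real n + B * ln (real n) + C
               + D / real n + E / real n ^ 2 + (F * of_bool (even n) + G) / real n ^ 3))
         \<in> O(\<lambda>n. 1 / real n ^ 4)
       \<and> \<bar>A - (- 2.6596412392892)\<bar> \<le> 5 / 10 ^ 14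
       \<and> \<bar>C - 2.042904116393455\<bar> \<le> 5 / 10 ^ 16"
proof (intro conjI)
  show "(\<lambda>n. measure_pmf.expectation (clairvoyant_comparisons_pmf n) real
            - (9 / 5 * real n * ln (real n) + A * real n + B * ln (real n) + C
               + D / real n + E / real n ^ 2 + (F * of_bool (even n) + G) / real n ^ 3))
         \<in> O(\<lambda>n. 1 / real n ^ 4)"
    unfolding assms expectation_clairvoyant
    using mean_comparisons_expansion unfolding cost_expansion_def .
  \<comment> \<open>The digits of \<open>C\<close> make the tightest demand: the interval for
    \<open>euler_mascheroni\<close> has width 2/10^16, and scaled by 77/40 it still fits the
    tolerance 5/10^16.\<close>
  have bounds: "ln (2::real) \<in> {0.69314718055994530941..0.69314718055994530942}"
    "euler_mascheroni \<in> {0.5772156649015328..(0.5772156649015330::real)}"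
    by (rule ln_2_bounds euler_mascheroni_bounds_16)+
  then show "\<bar>A - (- 2.6596412392892)\<bar> \<le> 5 / 10 ^ 14" "\<bar>C - 2.042904116393455\<bar> \<le> 5 / 10 ^ 16"
    unfolding assms atLeastAtMost_iff abs_le_iff by (simp_all add: field_simps)
qed

end
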